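(* Let $\mathcal P$ be a tight non-orientably regular polyhedron of type $\{p,q\}$ such that $\Gamma(\mathcal P)=\Delta(p,q)_{(i,j,a,b)}$, where $i,a\in\mathbb Z_p$ and $j,b\in\mathbb Z_q$. Then: (a) $p$ is an odd multiple of $4$; (b) $q$ is a multiple of $3$, and if $p\neq 4$ then $q$ is an odd multiple of $6$; (c) if $p/4\equiv 3 \pmod 4$ then $i=p/4-1$, and otherwise $i=3p/4-1$; (d) if $p\ne 4$ then $j=1+q/2$, and if $p=4$ then $j=1$ or $j=1+q/2$; (e) $a=1+p/2$; (f) $b=2$.
   Context: An (abstract) polyhedron is a partially ordered set whose elements have rank 0 (vertices), 1 (edges) or 2 (faces) such that: every flag (maximal chain) consists of one vertex, one edge and one face; each edge is incident with exactly two vertices and exactly two faces; the vertex–edge graph is connected; and for every vertex $F_0$ the poset $\{G:G>F_0\}$ is isomorphic to the vertex–edge incidence poset of a connected 2-regular graph. $\Phi^i$ is the flag differing from flag $\Phi$ only in its rank-$i$ element. Type $\{p,q\}$: faces have $p$ edges, vertices lie on $q$ edges. Regular: automorphism group $\Gamma$ transitive on flags; with base flag $\Phi$, $\Gamma=\langle\rho_0,\rho_1,\rho_2\rangle$ with $\rho_i:\Phi\mapsto\Phi^i$; $\sigma_1=\rho_0\rho_1$ (of order $p$), $\sigma_2=\rho_1\rho_2$ (of order $q$), $\Gamma^+=\langle\sigma_1,\sigma_2\rangle$; non-orientably regular means $\Gamma^+=\Gamma$. A finite polyhedron of type $\{p,q\}$ has at least $2pq$ flags and is tight if it has exactly $2pq$.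 $\Delta(p,q)_{(i,j,a,b)}$ denotes the quotient of the Coxeter group $[p,q]=\langle x,y,z\mid x^2=y^2=z^2=(xy)^p=(yz)^q=(xz)^2=1\rangle$ by the relations $\sigma_2^{-1}\sigma_1=\sigma_1^i\rho_1\sigma_2^j$ and $\sigma_2^{-2}\sigma_1=\sigma_1^a\sigma_2^b$, where $\rho_0,\rho_1,\rho_2,\sigma_1,\sigma_2$ stand for $x,y,z,xy,yz$; "$\Gamma(\mathcal P)=\Delta(p,q)_{(i,j,a,b)}$" means that $x,y,z\mapsto\rho_0,\rho_1,\rho_2$ induces an isomorphism. *)

theory Defs
  imports "HOL-Algebra.Algebra" "HOL-Number_Theory.Cong"
begin

section \<open>Multigraphs\<close>

text \<open>
  Graphs are loopless, but parallel edges are allowed: \<open>ends e\<close> is the set of the two endpoints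
  of the edge \<open>e\<close>. In particular the digon is a connected 2-regular graph.
\<close>

definition multigraph :: "'v set \<Rightarrow> 'e set \<Rightarrow> ('e \<Rightarrow> 'v set) \<Rightarrow> bool" where
  "multigraph V E ends \<longleftrightarrow> (\<forall>e\<in>E. ends e \<subseteq> V \<and> card (ends e) = 2)"

definition graph_connected :: "'v set \<Rightarrow> 'e set \<Rightarrow> ('e \<Rightarrow> 'v set) \<Rightarrow> bool" where
  "graph_connected V E ends \<longleftrightarrow>
     V \<noteq> {} \<and> (\<forall>u\<in>V. \<forall>v\<in>V. (u, v) \<in> {(x, y). \<exists>e\<in>E. x \<in> ends e \<and> y \<in> ends e}\<^sup>*)"

definition two_regular :: "'v set \<Rightarrow> 'e set \<Rightarrow> ('e \<Rightarrow> 'v set) \<Rightarrow> bool" where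
  "two_regular V E ends \<longleftrightarrow> (\<forall>v\<in>V. card {e\<in>E. v \<in> ends e} = 2)"

definition incidence_carrier :: "'v set \<Rightarrow> 'e set \<Rightarrow> ('v + 'e) set" where
  "incidence_carrier V E = V <+> E"

definition incidence_order :: "'v set \<Rightarrow> 'e set \<Rightarrow> ('e \<Rightarrow> 'v set) \<Rightarrow> ('v + 'e) rel" where
  "incidence_order V E ends =
     Id_on (V <+> E) \<union> {(Inl v, Inr e) | v e. v \<in> V \<and> e \<in> E \<and> v \<in> ends e}"

definition posets_isomorphic :: "'a set \<Rightarrow> 'a rel \<Rightarrow> 'b set \<Rightarrow> 'b rel \<Rightarrow> bool" where
  "posets_isomorphic A r B s \<longleftrightarrow>
     (\<exists>f. bij_betw f A B \<and> (\<forall>x\<in>A. \<forall>y\<in>A. (x, y) \<in> r \<longleftrightarrow> (f x, f y) \<in> s))"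


section \<open>Abstract polyhedra\<close>

record 'a ranked_poset =
  elems :: "'a set"
  le :: "'a rel"
  rk :: "'a \<Rightarrow> nat"

definition of_rank :: "'a ranked_poset \<Rightarrow> nat \<Rightarrow> 'a set" where
  "of_rank P n = {x \<in> elems P. rk P x = n}"

abbreviation "vertices P \<equiv> of_rank P 0"
abbreviation "edges P \<equiv> of_rank P 1"
abbreviation "faces P \<equiv> of_rank P 2"

definition flags :: "'a ranked_poset \<Rightarrow> 'a set set" where
  "flags P = {C. pred_on.maxchain (elems P) (\<lambda>x y. (x, y) \<in> le P) C}"

text \<open>
  In the last clause the graph may be taken on the type of the elements of the polyhedron, since
  any graph with this incidence poset can be transported to that type.
\<close>

definition polyhedron :: "'a ranked_poset \<Rightarrow> bool" where
  "polyhedron P \<longleftrightarrow>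
     partial_order_on (elems P) (le P) \<and>
     (\<forall>x\<in>elems P. rk P x \<in> {0, 1, 2}) \<and>
     (\<forall>x y. (x, y) \<in> le P \<and> x \<noteq> y \<longrightarrow> rk P x < rk P y) \<and>
     (\<forall>\<Phi>\<in>flags P. \<exists>v\<in>vertices P. \<exists>e\<in>edges P. \<exists>f\<in>faces P. \<Phi> = {v, e, f}) \<and>
     (\<forall>e\<in>edges P. card {v \<in> vertices P. (v, e) \<in> le P} = 2 \<and>
                  card {f \<in> faces P. (e, f) \<in> le P} = 2) \<and>
     graph_connected (vertices P) (edges P) (\<lambda>e. {v \<in> vertices P. (v, e) \<in> le P}) \<and>
     (\<forall>v\<in>vertices P. \<exists>(V :: 'a set) (E :: 'a set) ends.
        multigraph V E ends \<and> graph_connected V E ends \<and> two_regular V E ends \<and>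
        posets_isomorphic {x \<in> elems P. (v, x) \<in> le P \<and> x \<noteq> v} (le P)
          (incidence_carrier V E) (incidence_order V E ends))"

definition has_type :: "'a ranked_poset \<Rightarrow> nat \<Rightarrow> nat \<Rightarrow> bool" where
  "has_type P p q \<longleftrightarrow>
     (\<forall>f\<in>faces P. card {e \<in> edges P. (e, f) \<in> le P} = p) \<and>
     (\<forall>v\<in>vertices P. card {e \<in> edges P. (v, e) \<in> le P} = q)"

definition tight :: "'a ranked_poset \<Rightarrow> nat \<Rightarrow> nat \<Rightarrow> bool" where
  "tight P p q \<longleftrightarrow> finite (elems P) \<and> has_type P p q \<and> card (flags P) = 2 * p * q"


section \<open>Automorphism groups and regularity\<close>

definition aut_group :: "'a ranked_poset \<Rightarrow> ('a \<Rightarrow> 'a) monoid" where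
  "aut_group P = BijGroup (elems P) \<lparr>carrier :=
     {\<gamma> \<in> Bij (elems P).
        \<forall>x\<in>elems P. \<forall>y\<in>elems P. (x, y) \<in> le P \<longleftrightarrow> (\<gamma> x, \<gamma> y) \<in> le P}\<rparr>"

definition regular :: "'a ranked_poset \<Rightarrow> bool" where
  "regular P \<longleftrightarrow>
     (\<forall>\<Phi>\<in>flags P. \<forall>\<Psi>\<in>flags P. \<exists>\<gamma>\<in>carrier (aut_group P). \<gamma> ` \<Phi> = \<Psi>)"

definition flag_adjacent :: "'a ranked_poset \<Rightarrow> nat \<Rightarrow> 'a set \<Rightarrow> 'a set \<Rightarrow> bool" where
  "flag_adjacent P n \<Phi> \<Psi> \<longleftrightarrow> \<Phi> \<in> flags P \<and> \<Psi> \<in> flags P \<and> \<Psi> \<noteq> \<Phi> \<and>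
     {x \<in> \<Psi>. rk P x \<noteq> n} = {x \<in> \<Phi>. rk P x \<noteq> n}"

text \<open>
  Products in \<^const>\<open>aut_group\<close> are compositions of functions. Reading products in the opposite
  order instead changes nothing below: inversion is an isomorphism onto the opposite group that
  fixes the involutions \<open>\<rho> 0\<close>, \<open>\<rho> 1\<close>, \<open>\<rho> 2\<close>.
\<close>

definition base_reflections :: "'a ranked_poset \<Rightarrow> 'a set \<Rightarrow> (nat \<Rightarrow> 'a \<Rightarrow> 'a) \<Rightarrow> bool" where
  "base_reflections P \<Phi> \<rho> \<longleftrightarrow> \<Phi> \<in> flags P \<and>
     (\<forall>n\<in>{0, 1, 2}. \<rho> n \<in> carrier (aut_group P) \<and> flag_adjacent P n \<Phi> (\<rho> n ` \<Phi>))"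

definition sigma1 :: "'a ranked_poset \<Rightarrow> (nat \<Rightarrow> 'a \<Rightarrow> 'a) \<Rightarrow> 'a \<Rightarrow> 'a" where
  "sigma1 P \<rho> = \<rho> 0 \<otimes>\<^bsub>aut_group P\<^esub> \<rho> 1"

definition sigma2 :: "'a ranked_poset \<Rightarrow> (nat \<Rightarrow> 'a \<Rightarrow> 'a) \<Rightarrow> 'a \<Rightarrow> 'a" where
  "sigma2 P \<rho> = \<rho> 1 \<otimes>\<^bsub>aut_group P\<^esub> \<rho> 2"

definition rotation_subgroup :: "'a ranked_poset \<Rightarrow> (nat \<Rightarrow> 'a \<Rightarrow> 'a) \<Rightarrow> ('a \<Rightarrow> 'a) set" where
  "rotation_subgroup P \<rho> = generate (aut_group P) {sigma1 P \<rho>, sigma2 P \<rho>}"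

definition nonorientably_regular ::
    "'a ranked_poset \<Rightarrow> 'a set \<Rightarrow> (nat \<Rightarrow> 'a \<Rightarrow> 'a) \<Rightarrow> bool" where
  "nonorientably_regular P \<Phi> \<rho> \<longleftrightarrow> regular P \<and> base_reflections P \<Phi> \<rho> \<and>
     rotation_subgroup P \<rho> = carrier (aut_group P)"

lemma group_aut_group: "group (aut_group P)"
proof -
  let ?S = "elems P"
  let ?C = "{\<gamma> \<in> Bij ?S. \<forall>x\<in>?S. \<forall>y\<in>?S. (x, y) \<in> le P \<longleftrightarrow> (\<gamma> x, \<gamma> y) \<in> le P}"
  interpret B: group "BijGroup ?S" by (rule group_BijGroup)
  have "subgroup ?C (BijGroup ?S)"
  proof (rule B.subgroupI)
    show "?C \<subseteq> carrier (BijGroup ?S)" by (auto simp: BijGroup_def)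
    have "(\<lambda>x\<in>?S. x) \<in> ?C" by (simp add: id_Bij)
    then show "?C \<noteq> {}" by blast
  next
    fix g assume g: "g \<in> ?C"
    then have gb: "bij_betw g ?S ?S" by (simp add: Bij_def)
    have inv: "inv\<^bsub>BijGroup ?S\<^esub> g = (\<lambda>x\<in>?S. inv_into ?S g x)"
      using g by (simp add: inv_BijGroup)
    have in_S: "inv_into ?S g x \<in> ?S" and eq: "g (inv_into ?S g x) = x" if "x \<in> ?S" for x
      using gb that by (auto simp: bij_betw_def inv_into_into f_inv_into_f)
    have "(x, y) \<in> le P \<longleftrightarrow> (inv_into ?S g x, inv_into ?S g y) \<in> le P"
      if "x \<in> ?S" "y \<in> ?S" for x y
    proof -
      have "(inv_into ?S g x, inv_into ?S g y) \<in> le P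
          \<longleftrightarrow> (g (inv_into ?S g x), g (inv_into ?S g y)) \<in> le P"
        using g in_S[OF that(1)] in_S[OF that(2)] by blast
      then show ?thesis by (simp only: eq[OF that(1)] eq[OF that(2)])
    qed
    moreover have "(\<lambda>x\<in>?S. inv_into ?S g x) \<in> Bij ?S"
      using g by (simp add: restrict_inv_into_Bij)
    ultimately show "inv\<^bsub>BijGroup ?S\<^esub> g \<in> ?C"
      unfolding inv by simp
  next
    fix g h assume gh: "g \<in> ?C" "h \<in> ?C"
    have hS: "h x \<in> ?S" if "x \<in> ?S" for x
      using gh that Bij_imp_funcset by blast
    show "g \<otimes>\<^bsub>BijGroup ?S\<^esub> h \<in> ?C"
      using gh hS by (simp add: BijGroup_def compose_Bij compose_eq)
  qed
  then show ?thesis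
    unfolding aut_group_def by (rule B.subgroup_imp_group)
qed


section \<open>Groups given by generators and relations\<close>

text \<open>
  A word is a list of letters \<open>(g, s)\<close>, which stand for the generator \<open>g\<close> if \<open>s\<close> is true and for
  its inverse otherwise. A relation \<open>u = v\<close> is the pair \<open>(u, v)\<close>.
\<close>

type_synonym 'g word = "('g \<times> bool) list"

definition word_inv :: "'g word \<Rightarrow> 'g word" where
  "word_inv w = rev (map (\<lambda>(g, s). (g, \<not> s)) w)"

definition word_pow :: "'g word \<Rightarrow> int \<Rightarrow> 'g word" where
  "word_pow w k =
     (if 0 \<le> k then concat (replicate (nat k) w) else concat (replicate (nat (- k)) (word_inv w)))"

inductive word_equiv :: "('g word \<times> 'g word) set \<Rightarrow> 'g word \<Rightarrow> 'g word \<Rightarrow> bool"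
  for R where
    refl: "word_equiv R w w"
  | sym: "word_equiv R u v \<Longrightarrow> word_equiv R v u"
  | trans: "word_equiv R u v \<Longrightarrow> word_equiv R v w \<Longrightarrow> word_equiv R u w"
  | cancel: "word_equiv R (u @ [(g, s), (g, \<not> s)] @ v) (u @ v)"
  | rel: "(r, t) \<in> R \<Longrightarrow> word_equiv R (u @ r @ v) (u @ t @ v)"

definition word_class :: "('g word \<times> 'g word) set \<Rightarrow> 'g word \<Rightarrow> 'g word set" where
  "word_class R u = {w. word_equiv R u w}"

definition presented_group :: "('g word \<times> 'g word) set \<Rightarrow> 'g word set monoid" where
  "presented_group R =
     \<lparr>carrier = range (word_class R),
      monoid.mult = (\<lambda>A B. \<Union>u\<in>A. \<Union>v\<in>B. word_class R (u @ v)),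
      monoid.one = word_class R []\<rparr>"

lemma word_equiv_context:
  "word_equiv R u v \<Longrightarrow> word_equiv R (c @ u @ d) (c @ v @ d)"
proof (induction rule: word_equiv.induct)
  case (cancel u g s v)
  show ?case using word_equiv.cancel[of R "c @ u" g s "v @ d"] by simp
next
  case (rel r t u v)
  then show ?case using word_equiv.rel[of r t R "c @ u" "v @ d"] by simp
qed (blast intro: word_equiv.intros)+

lemma word_equiv_append:
  assumes "word_equiv R u u'" "word_equiv R v v'"
  shows "word_equiv R (u @ v) (u' @ v')"
  using word_equiv_context[OF assms(1), of "[]" v] word_equiv_context[OF assms(2), of u' "[]"]
  by (auto intro: word_equiv.trans)

lemma word_class_eq_iff: "word_class R u = word_class R v \<longleftrightarrow> word_equiv R u v"
  unfolding word_class_def set_eq_iff mem_Collect_eq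
  by (meson word_equiv.refl word_equiv.sym word_equiv.trans)

lemma word_class_self: "u \<in> word_class R u"
  by (simp add: word_class_def word_equiv.refl)

lemma presented_group_mult:
  "word_class R u \<otimes>\<^bsub>presented_group R\<^esub> word_class R v = word_class R (u @ v)"
proof -
  have eq: "word_class R (u' @ v') = word_class R (u @ v)"
    if "u' \<in> word_class R u" "v' \<in> word_class R v" for u' v'
  proof -
    have "word_equiv R u u'" "word_equiv R v v'"
      using that by (simp_all add: word_class_def)
    then have "word_equiv R (u @ v) (u' @ v')" by (rule word_equiv_append)
    then have "word_class R (u @ v) = word_class R (u' @ v')"
      by (simp only: word_class_eq_iff)
    then show ?thesis by (rule HOL.sym)
  qed
  have "(\<Union>u'\<in>word_class R u. \<Union>v'\<in>word_class R v. word_class R (u' @ v')) =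
        (\<Union>u'\<in>word_class R u. \<Union>v'\<in>word_class R v. word_class R (u @ v))"
    by (intro SUP_cong HOL.refl eq)
  also have "\<dots> = word_class R (u @ v)"
    using word_class_self[of u R] word_class_self[of v R] by blast
  finally show ?thesis
    by (simp add: presented_group_def)
qed

lemma word_equiv_inv: "word_equiv R (word_inv w @ w) []"
proof (induction w)
  case Nil
  show ?case by (simp add: word_inv_def word_equiv.refl)
next
  case (Cons l w)
  obtain g s where l: "l = (g, s)" by (cases l)
  have "word_equiv R (word_inv w @ [(g, \<not> s), (g, \<not> \<not> s)] @ w) (word_inv w @ w)"
    by (rule word_equiv.cancel)
  then show ?case
    using Cons.IH by (auto simp: l word_inv_def intro: word_equiv.trans)
qed

lemma group_presented_group: "group (presented_group R)"
proof (rule groupI)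
  let ?G = "presented_group R"
  have car: "carrier ?G = range (word_class R)" and one: "\<one>\<^bsub>?G\<^esub> = word_class R []"
    by (simp_all add: presented_group_def)
  show "x \<otimes>\<^bsub>?G\<^esub> y \<in> carrier ?G" if "x \<in> carrier ?G" "y \<in> carrier ?G" for x y
    using that by (auto simp: car presented_group_mult)
  show "\<one>\<^bsub>?G\<^esub> \<in> carrier ?G" by (simp add: car one)
  show "x \<otimes>\<^bsub>?G\<^esub> y \<otimes>\<^bsub>?G\<^esub> z = x \<otimes>\<^bsub>?G\<^esub> (y \<otimes>\<^bsub>?G\<^esub> z)"
    if "x \<in> carrier ?G" "y \<in> carrier ?G" "z \<in> carrier ?G" for x y z
    using that by (auto simp: car presented_group_mult)
  show "\<one>\<^bsub>?G\<^esub> \<otimes>\<^bsub>?G\<^esub> x = x" if "x \<in> carrier ?G" for x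
    using that by (auto simp: car one presented_group_mult)
  show "\<exists>y\<in>carrier ?G. y \<otimes>\<^bsub>?G\<^esub> x = \<one>\<^bsub>?G\<^esub>" if "x \<in> carrier ?G" for x
  proof -
    from that obtain w where x: "x = word_class R w" by (auto simp: car)
    have "word_class R (word_inv w) \<otimes>\<^bsub>?G\<^esub> x = \<one>\<^bsub>?G\<^esub>"
      by (simp add: x one presented_group_mult word_class_eq_iff word_equiv_inv)
    then show ?thesis by (auto simp: car)
  qed
qed


section \<open>The groups \<open>Delta p q i j a b\<close>\<close>

datatype generator = gx | gy | gz

abbreviation letter :: "generator \<Rightarrow> generator word" where
  "letter g \<equiv> [(g, True)]"

definition s1 :: "generator word" where "s1 = letter gx @ letter gy"
definition s2 :: "generator word" where "s2 = letter gy @ letter gz"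

definition coxeter_relations :: "nat \<Rightarrow> nat \<Rightarrow> (generator word \<times> generator word) set" where
  "coxeter_relations p q =
     {(word_pow (letter gx) 2, []), (word_pow (letter gy) 2, []), (word_pow (letter gz) 2, []),
      (word_pow (letter gx @ letter gy) (int p), []),
      (word_pow (letter gy @ letter gz) (int q), []),
      (word_pow (letter gx @ letter gz) 2, [])}"

definition Delta_relations ::
    "nat \<Rightarrow> nat \<Rightarrow> int \<Rightarrow> int \<Rightarrow> int \<Rightarrow> int \<Rightarrow> (generator word \<times> generator word) set" where
  "Delta_relations p q i j a b = coxeter_relations p q \<union>
     {(word_pow s2 (-1) @ s1, word_pow s1 i @ letter gy @ word_pow s2 j),
      (word_pow s2 (-2) @ s1, word_pow s1 a @ word_pow s2 b)}"

text \<open>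
  Because \<open>s1\<close> and \<open>s2\<close> have orders dividing \<open>p\<close> and \<open>q\<close>, the group depends only on the residues
  of \<open>i\<close>, \<open>a\<close> modulo \<open>p\<close> and of \<open>j\<close>, \<open>b\<close> modulo \<open>q\<close>; integers here represent residue classes.
\<close>

definition Delta :: "nat \<Rightarrow> nat \<Rightarrow> int \<Rightarrow> int \<Rightarrow> int \<Rightarrow> int \<Rightarrow> generator word set monoid" where
  "Delta p q i j a b = presented_group (Delta_relations p q i j a b)"

definition Delta_gen ::
    "nat \<Rightarrow> nat \<Rightarrow> int \<Rightarrow> int \<Rightarrow> int \<Rightarrow> int \<Rightarrow> generator \<Rightarrow> generator word set" where
  "Delta_gen p q i j a b g = word_class (Delta_relations p q i j a b) (letter g)"

definition aut_group_is_Delta ::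
    "'a ranked_poset \<Rightarrow> (nat \<Rightarrow> 'a \<Rightarrow> 'a) \<Rightarrow> nat \<Rightarrow> nat \<Rightarrow> int \<Rightarrow> int \<Rightarrow> int \<Rightarrow> int \<Rightarrow> bool" where
  "aut_group_is_Delta P \<rho> p q i j a b \<longleftrightarrow>
     (\<exists>h \<in> iso (Delta p q i j a b) (aut_group P).
        h (Delta_gen p q i j a b gx) = \<rho> 0 \<and>
        h (Delta_gen p q i j a b gy) = \<rho> 1 \<and>
        h (Delta_gen p q i j a b gz) = \<rho> 2)"

end

theory Submission
  imports Defs
begin

text \<open>
  Write \<open>x = \<sigma>\<^sub>1\<close>, \<open>y = \<sigma>\<^sub>2\<close>, \<open>r = \<rho>\<^sub>1\<close>. An automorphism fixing a flag is trivial, so the representation of a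
  group element as \<open>x\<^sup>k r\<^sup>e y\<^sup>l\<close> is unique, and counting flags shows that tightness makes every vertex an
  \<open>x\<^sup>k v\<close>. Since \<open>r\<close> inverts \<open>x\<close> and \<open>y\<close>, the two defining relations of \<open>\<Delta>\<close> can be combined with their
  inverses and \<open>r\<close>-conjugates: \<open>y\<^bsup>b-2\<^esup>\<close> is central, \<open>x\<close> inverts \<open>y\<^bsup>j+2\<^esup>\<close>, and \<open>y\<close> inverts \<open>x\<^bsup>i-2\<^esup>\<close>.
  Comparing two normal forms of \<open>y\<^sup>j x\<close> then gives \<open>2a = 2\<close> modulo \<open>p\<close> and \<open>2b = 4\<close>, \<open>2j = 2\<close> modulo
  \<open>q\<close>. The exponents \<open>k\<close> for which \<open>x\<close> inverts \<open>y\<^sup>k\<close> form a subgroup of the integers containing \<open>q\<close>,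
  \<open>j + 2\<close> and \<open>6\<close> but not \<open>2\<close>; whether it contains \<open>j - 1\<close> separates the case \<open>p = 4\<close>, where
  \<open>2i = 0\<close> modulo \<open>p\<close>, from the case where it is generated by \<open>6\<close>. In the latter, let \<open>h = p/2\<close>; then
  \<open>x\<^sup>h\<close> and its conjugates by \<open>y\<^sup>2\<close> and \<open>y\<^sup>4\<close> have trivial product, and tracing the action of \<open>y\<close> on the
  vertices \<open>x\<^sup>k v\<close> determines \<open>p\<close> and \<open>i\<close>.
\<close>

section \<open>Groups generated by two rotations\<close>

lemma (in group) conj_int_pow:
  assumes g: "g \<in> carrier G" and z: "z \<in> carrier G" and w: "w \<in> carrier G"
    and conj: "g \<otimes> z = w \<otimes> g"
  shows "g \<otimes> z [^] (k::int) = w [^] k \<otimes> g"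
proof -
  have hom: "(\<lambda>v. g \<otimes> v \<otimes> inv g) \<in> hom G G"
  proof (rule homI)
    fix u v assume uv: "u \<in> carrier G" "v \<in> carrier G"
    have "inv g \<otimes> (g \<otimes> (v \<otimes> inv g)) = v \<otimes> inv g"
      using uv g by (simp flip: m_assoc)
    then show "g \<otimes> (u \<otimes> v) \<otimes> inv g = g \<otimes> u \<otimes> inv g \<otimes> (g \<otimes> v \<otimes> inv g)"
      using uv g by (simp add: m_assoc)
  qed (simp add: g)
  have "g \<otimes> z [^] k \<otimes> inv g = (g \<otimes> z \<otimes> inv g) [^] k"
    using hom_int_pow[OF hom z is_group is_group] .
  also have "\<dots> = w [^] k"
    using conj g z w by (simp add: m_assoc)
  finally show ?thesis
    using g z w by (metis int_pow_closed inv_closed inv_solve_right m_closed inv_inv)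
qed

text \<open>These are the \<open>k\<close> for which conjugation by \<open>w\<close> inverts
  \<open>z^k\<close>. The condition is written as an exchange rule, the form in which later proofs
  move \<open>w\<close> across a power of \<open>z\<close>.\<close>

definition (in group) inverted_powers :: "'a \<Rightarrow> 'a \<Rightarrow> int set" where
  "inverted_powers z w = {k. z [^] k \<otimes> w = w \<otimes> z [^] (- k)}"

text \<open>The set is closed under sums, negatives and hence integer multiples, so it contains the
  gcd by Bezout. Taking \<open>k = l\<close> yields all multiples of a single element.\<close>

lemma (in group) inverted_powers_gcd:
  assumes z: "z \<in> carrier G" and w: "w \<in> carrier G"
    and k: "k \<in> inverted_powers z w" and l: "l \<in> inverted_powers z w"
    and dvd: "gcd k l dvd m"
  shows "m \<in> inverted_powers z w"
proof -
  have add: "k + l \<in> inverted_powers z w"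
    if k: "k \<in> inverted_powers z w" and l: "l \<in> inverted_powers z w" for k l
  proof -
    have "z [^] (k + l) \<otimes> w = z [^] k \<otimes> (z [^] l \<otimes> w)"
      using z w by (simp add: int_pow_mult m_assoc)
    also have "\<dots> = z [^] k \<otimes> w \<otimes> z [^] (- l)"
      using l z w by (simp add: inverted_powers_def m_assoc)
    also have "\<dots> = w \<otimes> (z [^] (- k) \<otimes> z [^] (- l))"
      using k z w by (simp add: inverted_powers_def m_assoc)
    also have "\<dots> = w \<otimes> z [^] (- (k + l))"
      using z by (simp flip: int_pow_mult)
    finally show ?thesis by (simp add: inverted_powers_def)
  qed
  have neg: "- k \<in> inverted_powers z w" if "k \<in> inverted_powers z w" for k
  proof -
    have "z [^] (- k) \<otimes> (z [^] k \<otimes> w) \<otimes> z [^] k = z [^] (- k) \<otimes> (w \<otimes> z [^] (- k)) \<otimes> z [^] k"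
      using that by (simp add: inverted_powers_def)
    moreover have "z [^] (- k) \<otimes> (z [^] k \<otimes> w) \<otimes> z [^] k = w \<otimes> z [^] k"
      using z w by (simp flip: m_assoc int_pow_mult)
    moreover have "z [^] (- k) \<otimes> (w \<otimes> z [^] (- k)) \<otimes> z [^] k = z [^] (- k) \<otimes> w"
      using z w by (simp add: m_assoc int_pow_neg)
    ultimately show ?thesis by (simp add: inverted_powers_def)
  qed
  have mult: "n * k \<in> inverted_powers z w" if k: "k \<in> inverted_powers z w" for n k
  proof (induction n rule: int_induct[where k = 0])
    case base
    show ?case using w by (simp add: inverted_powers_def)
  next
    case (step1 n)
    then show ?case using add[OF k step1(2)] by (simp add: algebra_simps)
  next
    case (step2 n)
    then show ?case using add[OF neg[OF k] step2(2)] by (simp add: algebra_simps)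
  qed
  obtain u v where "u * k + v * l = gcd k l" using bezout_int by blast
  then have "gcd k l \<in> inverted_powers z w" using add mult k l by metis
  then show ?thesis using dvd mult by (metis dvd_def mult.commute)
qed

text \<open>In \<open>2 * t = m * n\<close> the factor \<open>n\<close> must be odd, since otherwise
  \<open>m\<close> would divide \<open>t\<close>. So apart from 0 the only solution of
  \<open>2 * t = 0\<close> modulo \<open>m\<close> is \<open>m div 2\<close>; this is how the
  congruences for doubled exponents are halved.\<close>

lemma dvd_double_not_dvd:
  fixes m t :: int
  assumes "m dvd 2 * t" "\<not> m dvd t"
  shows "even m" "m dvd t - m div 2"
proof -
  obtain n where n: "2 * t = m * n" using assms(1) by blast
  have "odd n"
  proof
    assume "even n"
    then obtain n' where "n = 2 * n'" by blast
    then have "t = m * n'" using n by simp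
    then show False using assms(2) by simp
  qed
  then show "even m" using n by (metis dvd_triv_left even_mult_iff)
  then obtain h where h: "m = 2 * h" by blast
  obtain n' where "n = 2 * n' + 1" using \<open>odd n\<close> by (rule oddE)
  then have "t - h = m * n'" using n h by (simp add: algebra_simps)
  then show "m dvd t - m div 2" using h by simp
qed

section \<open>Rewriting products of powers of \<open>x\<close>, \<open>y\<close> and
  \<open>r\<close>\<close>

locale rotation_pair = group G for G (structure) +
  fixes x y r
  assumes x: "x \<in> carrier G" and y: "y \<in> carrier G" and r: "r \<in> carrier G"
    and rr: "r \<otimes> r = \<one>"
    and rx: "r \<otimes> x \<otimes> r = inv x"
    and ry: "r \<otimes> y \<otimes> r = inv y"
    and gen_pow_1y: "x \<otimes> y \<otimes> (x \<otimes> y) = \<one>"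
begin

abbreviation xp :: "int \<Rightarrow> 'a" where "xp k \<equiv> x [^] k"
abbreviation yp :: "int \<Rightarrow> 'a" where "yp k \<equiv> y [^] k"

text \<open>The exponent 1 stays visible, so that every factor is syntactically a power and the
  rules for adding exponents apply to it.\<close>

declare int_pow_1 [simp del]

lemma gen_pow_1: "xp 1 = x" "yp 1 = y" using x y by (simp_all add: int_pow_1)

lemma X_X: "xp k \<otimes> xp l = xp (k + l)"
  and Y_Y: "yp k \<otimes> yp l = yp (k + l)"
  by (simp_all add: int_pow_mult x y)

lemma X_X': "z \<in> carrier G \<Longrightarrow> xp k \<otimes> (xp l \<otimes> z) = xp (k + l) \<otimes> z"
  and Y_Y': "z \<in> carrier G \<Longrightarrow> yp k \<otimes> (yp l \<otimes> z) = yp (k + l) \<otimes> z"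
  by (simp_all add: X_X Y_Y x y flip: m_assoc)

lemma r_X: "r \<otimes> xp k = xp (- k) \<otimes> r"
  and r_Y: "r \<otimes> yp k = yp (- k) \<otimes> r"
proof -
  have "r \<otimes> z [^] k = z [^] (- k) \<otimes> r" if z: "z \<in> carrier G" and rz: "r \<otimes> z \<otimes> r = inv z" for z
  proof -
    have "r \<otimes> z \<otimes> r \<otimes> r = inv z \<otimes> r" using rz by simp
    then have "r \<otimes> z = inv z \<otimes> r" using z r rr by (simp add: m_assoc)
    from conj_int_pow[OF r z _ this] show ?thesis
      using z by (simp add: int_pow_inv int_pow_neg)
  qed
  then show "r \<otimes> xp k = xp (- k) \<otimes> r" "r \<otimes> yp k = yp (- k) \<otimes> r"
    using x y rx ry by blast+
qed

lemma X_r': "z \<in> carrier G \<Longrightarrow> r \<otimes> (xp k \<otimes> z) = xp (- k) \<otimes> (r \<otimes> z)"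
  and Y_r: "yp k \<otimes> r = r \<otimes> yp (- k)"
  and Y_r': "z \<in> carrier G \<Longrightarrow> yp k \<otimes> (r \<otimes> z) = r \<otimes> (yp (- k) \<otimes> z)"
  and r_r': "z \<in> carrier G \<Longrightarrow> r \<otimes> (r \<otimes> z) = z"
  by (simp_all add: r_X r_Y rr x y r flip: m_assoc)

text \<open>Moves powers of \<open>x\<close> to the left of \<open>r\<close> and powers of \<open>y\<close> to its right.\<close>
lemmas normal_form_simps = m_assoc x y r rr X_X Y_Y X_X' Y_Y' r_X X_r' Y_r Y_r' r_r'

lemma X_solve: "\<lbrakk>z \<in> carrier G; w \<in> carrier G\<rbrakk> \<Longrightarrow> xp k \<otimes> z = w \<longleftrightarrow> z = xp (- k) \<otimes> w"
  by (auto simp: X_X' x)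

text \<open>This is \<open>(x y)^2 = 1\<close> turned into an exchange rule. In the application
  \<open>x y\<close> is the product of the commuting reflections \<open>\<rho> 0\<close> and
  \<open>\<rho> 2\<close>.\<close>

lemma Y_X: "yp 1 \<otimes> xp 1 = xp (- 1) \<otimes> yp (- 1)"
proof -
  have "xp 1 \<otimes> (yp 1 \<otimes> (xp 1 \<otimes> yp 1)) = \<one>" using gen_pow_1y by (simp add: gen_pow_1 x y m_assoc)
  then have "yp 1 \<otimes> (xp 1 \<otimes> yp 1) = xp (- 1)" using X_solve by (simp add: x y)
  then have "yp 1 \<otimes> (xp 1 \<otimes> yp 1) \<otimes> yp (- 1) = xp (- 1) \<otimes> yp (- 1)" by simp
  then show ?thesis by (simp add: normal_form_simps)
qed

text \<open>The direction is opposite to \<open>Y_r'\<close>, so the rule stays out of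
  \<open>normal_form_simps\<close>. It serves conjugations by \<open>r\<close>, where
  \<open>r\<close> travels to the right past all powers and cancels.\<close>

lemma r_Y': "z \<in> carrier G \<Longrightarrow> r \<otimes> (yp k \<otimes> z) = yp (- k) \<otimes> (r \<otimes> z)"
  by (simp add: r_Y x y r flip: m_assoc)

text \<open>The three claims come from inverting the equation, from conjugating it by
  \<open>r\<close>, which negates all exponents, and from doing both.\<close>

lemma inv_flip:
  assumes "yp k \<otimes> xp l = xp m \<otimes> yp n"
  shows "yp (- n) \<otimes> xp (- m) = xp (- l) \<otimes> yp (- k)"
    and "yp (- k) \<otimes> xp (- l) = xp (- m) \<otimes> yp (- n)"
    and "yp n \<otimes> xp m = xp l \<otimes> yp k"
proof -
  have flip: "yp (- n) \<otimes> xp (- m) = xp (- l) \<otimes> yp (- k)"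
    if "yp k \<otimes> xp l = xp m \<otimes> yp n" for k l m n
  proof -
    have "inv (yp k \<otimes> xp l) = inv (xp m \<otimes> yp n)" using that by simp
    then show ?thesis by (simp add: x y inv_mult_group int_pow_neg)
  qed
  have conj: "yp (- k) \<otimes> xp (- l) = xp (- m) \<otimes> yp (- n)"
    if "yp k \<otimes> xp l = xp m \<otimes> yp n" for k l m n
  proof -
    have "r \<otimes> (yp k \<otimes> xp l) \<otimes> r = r \<otimes> (xp m \<otimes> yp n) \<otimes> r" using that by simp
    then show ?thesis by (simp add: m_assoc x y r r_X r_Y X_r' r_Y' rr)
  qed
  show "yp (- n) \<otimes> xp (- m) = xp (- l) \<otimes> yp (- k)" "yp (- k) \<otimes> xp (- l) = xp (- m) \<otimes> yp (- n)"
    using flip conj assms by blast+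
  show "yp n \<otimes> xp m = xp l \<otimes> yp k"
    using conj[OF flip[OF assms]] by simp
qed

end

section \<open>Congruences forced by the two relations of \<open>Delta\<close>\<close>

locale Delta_rotation_pair = rotation_pair +
  fixes p q i j a b :: int
  assumes p_pos: "p > 0" and q_pos: "q > 0"
    and relB: "yp (- 1) \<otimes> xp 1 = xp i \<otimes> (r \<otimes> yp j)"
    and relC: "yp (- 2) \<otimes> xp 1 = xp a \<otimes> yp b"
    and ord_x: "xp k = \<one> \<longleftrightarrow> p dvd k" and ord_y: "yp k = \<one> \<longleftrightarrow> q dvd k"
    and indep: "xp k \<otimes> yp l = \<one> \<Longrightarrow> xp k = \<one>"
    and r_neq: "r \<noteq> xp k \<otimes> yp l"
begin

text \<open>By \<open>indep\<close> the cyclic groups of \<open>x\<close> and \<open>y\<close> meet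
  only in the identity, so after cancelling the outer powers both remaining factors are
  trivial.\<close>

lemma normal_form_unique:
  assumes "xp k \<otimes> yp l = xp k' \<otimes> yp l'"
  shows "p dvd k - k'" "q dvd l - l'"
proof -
  have "xp (- k') \<otimes> (xp k \<otimes> yp l) \<otimes> yp (- l') = xp (- k') \<otimes> (xp k' \<otimes> yp l') \<otimes> yp (- l')"
    using assms by simp
  then have e: "xp (k - k') \<otimes> yp (l - l') = \<one>" by (simp add: normal_form_simps)
  then have "xp (k - k') = \<one>" by (rule indep)
  moreover from this have "yp (l - l') = \<one>" using e by (simp add: y)
  ultimately show "p dvd k - k'" "q dvd l - l'" by (simp_all add: ord_x ord_y)
qed

lemma normal_form_r_unique:
  assumes "xp k \<otimes> (r \<otimes> yp l) = xp k' \<otimes> (r \<otimes> yp l')"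
  shows "p dvd k - k'" "q dvd l - l'"
proof -
  have "xp k \<otimes> (r \<otimes> yp l) \<otimes> r = xp k' \<otimes> (r \<otimes> yp l') \<otimes> r" using assms by simp
  then have "xp k \<otimes> yp (- l) = xp k' \<otimes> yp (- l')" by (simp add: normal_form_simps)
  from normal_form_unique[OF this] show "p dvd k - k'" "q dvd l - l'"
    by (simp_all add: dvd_diff_commute)
qed

text \<open>Cancelling the outer powers would write \<open>r\<close> as a power of \<open>x\<close>
  times a power of \<open>y\<close>, against \<open>r_neq\<close>.\<close>

lemma normal_form_disjoint: "xp k \<otimes> (r \<otimes> yp l) \<noteq> xp k' \<otimes> yp l'"
proof
  assume "xp k \<otimes> (r \<otimes> yp l) = xp k' \<otimes> yp l'"
  then have "xp (- k) \<otimes> (xp k \<otimes> (r \<otimes> yp l)) \<otimes> yp (- l) = xp (- k) \<otimes> (xp k' \<otimes> yp l') \<otimes> yp (- l)"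
    by simp
  then have "r = xp (k' - k) \<otimes> yp (l' - l)" by (simp add: normal_form_simps)
  then show False using r_neq by blast
qed

lemma xp_cong: "p dvd k - l \<Longrightarrow> xp k = xp l"
  by (metis ord_x X_X add.commute diff_add_cancel int_pow_closed l_one x)

lemma yp_cong: "q dvd k - l \<Longrightarrow> yp k = yp l"
  by (metis ord_y Y_Y add.commute diff_add_cancel int_pow_closed l_one y)

text \<open>Inversion followed by conjugation with \<open>r\<close>, applied to \<open>relB\<close>:
  the counterpart of the third claim of \<open>inv_flip\<close> for a relation that contains
  \<open>r\<close>.\<close>

lemma relB_rev: "yp (- j) \<otimes> xp 1 = xp (- i) \<otimes> (r \<otimes> yp 1)"
proof -
  have inv_r: "inv r = r" using rr r by (simp add: inv_equality)
  have "inv (yp (- 1) \<otimes> xp 1) = inv (xp i \<otimes> (r \<otimes> yp j))" using relB by simp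
  then have "xp (- 1) \<otimes> yp 1 = yp (- j) \<otimes> (r \<otimes> xp (- i))"
    by (simp add: x y r inv_r inv_mult_group int_pow_neg m_assoc)
  then have "r \<otimes> (xp (- 1) \<otimes> yp 1) \<otimes> r = r \<otimes> (yp (- j) \<otimes> (r \<otimes> xp (- i))) \<otimes> r" by simp
  then have "xp 1 \<otimes> yp (- 1) = yp j \<otimes> (xp (- i) \<otimes> r)"
    by (simp add: m_assoc x y r rr r_X r_Y X_r' r_Y' r_r')
  then have "yp (- j) \<otimes> (xp 1 \<otimes> yp (- 1)) \<otimes> yp 1 = yp (- j) \<otimes> (yp j \<otimes> (xp (- i) \<otimes> r)) \<otimes> yp 1"
    by simp
  then show ?thesis by (simp add: normal_form_simps)
qed

lemma Y_X': "yp 1 \<otimes> (xp 1 \<otimes> yp 1) = xp (- 1)"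
proof -
  have "yp 1 \<otimes> xp 1 \<otimes> yp 1 = xp (- 1) \<otimes> yp (- 1) \<otimes> yp 1" using Y_X by simp
  then show ?thesis by (simp add: normal_form_simps)
qed

lemma X_Y': "xp 1 \<otimes> (yp 1 \<otimes> xp 1) = yp (- 1)"
proof -
  have "xp 1 \<otimes> (yp 1 \<otimes> xp 1) = xp 1 \<otimes> (xp (- 1) \<otimes> yp (- 1))" using Y_X by simp
  then show ?thesis by (simp add: normal_form_simps)
qed

text \<open>The element \<open>y\<^sup>-\<^sup>1 x y\<^sup>-\<^sup>j = x\<^sup>i r\<close> is an involution, and so is \<open>x y\<close>.\<close>
lemma inverted_y: "j + 2 \<in> inverted_powers y (xp 1)"
proof -
  have "yp (- 1) \<otimes> xp 1 \<otimes> yp (- j) = xp i \<otimes> r" using relB by (simp add: normal_form_simps)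
  then have "yp (- 1) \<otimes> xp 1 \<otimes> yp (- j) \<otimes> (yp (- 1) \<otimes> xp 1 \<otimes> yp (- j)) = xp i \<otimes> r \<otimes> (xp i \<otimes> r)"
    by simp
  also have "\<dots> = \<one>" by (simp add: normal_form_simps)
  finally have "yp 1 \<otimes> (yp (- 1) \<otimes> xp 1 \<otimes> yp (- j) \<otimes> (yp (- 1) \<otimes> xp 1 \<otimes> yp (- j))) \<otimes> yp (- 1)
      = yp 1 \<otimes> yp (- 1)" by (simp add: x y)
  then have "xp 1 \<otimes> (yp (- j - 1) \<otimes> (xp 1 \<otimes> yp (- j - 1))) = \<one>" by (simp add: normal_form_simps)
  then have "yp (- j - 1) \<otimes> (xp 1 \<otimes> yp (- j - 1)) = yp 1 \<otimes> (xp 1 \<otimes> yp 1)"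
    by (subst (asm) X_solve) (simp_all add: x y Y_X')
  then have "yp (j + 1) \<otimes> (yp (- j - 1) \<otimes> (xp 1 \<otimes> yp (- j - 1))) \<otimes> yp (- 1)
      = yp (j + 1) \<otimes> (yp 1 \<otimes> (xp 1 \<otimes> yp 1)) \<otimes> yp (- 1)" by simp
  then have "xp 1 \<otimes> yp (- j - 2) = yp (j + 2) \<otimes> xp 1" by (simp add: normal_form_simps algebra_simps)
  then show ?thesis by (simp add: inverted_powers_def)
qed

text \<open>Here the involution is \<open>x^(-i) y^(-1) x = r y^j\<close>. Its square being trivial
  gives an exchange rule for \<open>x^(i-1)\<close>, and \<open>x y x = y^(-1)\<close> absorbs one
  more factor \<open>x\<close>.\<close>

lemma inverted_x: "i - 2 \<in> inverted_powers x (yp 1)"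
proof -
  have "xp (- i) \<otimes> (yp (- 1) \<otimes> xp 1) = xp (- i) \<otimes> (xp i \<otimes> (r \<otimes> yp j))"
    using relB by simp
  then have "xp (- i) \<otimes> (yp (- 1) \<otimes> xp 1) = r \<otimes> yp j" by (simp add: normal_form_simps)
  then have "xp (- i) \<otimes> (yp (- 1) \<otimes> xp 1) \<otimes> (xp (- i) \<otimes> (yp (- 1) \<otimes> xp 1)) = r \<otimes> yp j \<otimes> (r \<otimes> yp j)"
    by simp
  also have "\<dots> = \<one>" by (simp add: normal_form_simps)
  finally have "xp i \<otimes> (xp (- i) \<otimes> (yp (- 1) \<otimes> xp 1) \<otimes> (xp (- i) \<otimes> (yp (- 1) \<otimes> xp 1))) \<otimes> xp (- 1) \<otimes> yp 1
      = xp i \<otimes> xp (- 1) \<otimes> yp 1" by (simp add: x y)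
  then have "yp (- 1) \<otimes> xp (1 - i) = xp (i - 1) \<otimes> yp 1" by (simp add: normal_form_simps)
  from inv_flip(2)[OF this] have "yp 1 \<otimes> xp (i - 1) = xp (1 - i) \<otimes> yp (- 1)" by simp
  then have "xp (i - 2) \<otimes> (yp 1 \<otimes> xp (i - 1)) \<otimes> xp (1 - i)
      = xp (i - 2) \<otimes> (xp (1 - i) \<otimes> yp (- 1)) \<otimes> xp (1 - i)" by simp
  then have "xp (i - 2) \<otimes> yp 1 = xp (- 1) \<otimes> (yp (- 1) \<otimes> xp (1 - i))" by (simp add: normal_form_simps)
  also have "\<dots> = xp (- 1) \<otimes> (xp 1 \<otimes> (yp 1 \<otimes> xp 1) \<otimes> xp (1 - i))" by (simp add: X_Y')
  also have "\<dots> = yp 1 \<otimes> xp (- (i - 2))" by (simp add: normal_form_simps)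
  finally show ?thesis by (simp add: inverted_powers_def)
qed

text \<open>\<open>relC\<close> gives \<open>x^a = y^(-2) x y^(-b)\<close>, while its flipped form
  gives \<open>x^a = y^(-b) x y^(-2)\<close>. Equating the two shows that \<open>y^(b-2)\<close>
  commutes with \<open>x\<close>.\<close>

lemma Y_comm: "yp (b - 2) \<otimes> xp k = xp k \<otimes> yp (b - 2)"
proof -
  have "yp (- 2) \<otimes> xp 1 \<otimes> yp (- b) = xp a" using relC by (simp add: normal_form_simps)
  moreover have "yp (- b) \<otimes> (yp b \<otimes> xp a) = yp (- b) \<otimes> (xp 1 \<otimes> yp (- 2))"
    using inv_flip(3)[OF relC] by simp
  ultimately have "yp b \<otimes> (yp (- 2) \<otimes> xp 1 \<otimes> yp (- b)) \<otimes> yp b = yp b \<otimes> (yp (- b) \<otimes> (xp 1 \<otimes> yp (- 2))) \<otimes> yp b"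
    by (simp add: normal_form_simps)
  then have "yp (b - 2) \<otimes> x = x \<otimes> yp (b - 2)" by (simp add: normal_form_simps gen_pow_1)
  from conj_int_pow[OF _ x x this] y show ?thesis by simp
qed

text \<open>The element \<open>y^(b-2)\<close> commutes with \<open>x\<close> and \<open>y\<close>,
  and by \<open>relB\<close> the reflection \<open>r\<close> is a product of their powers. But
  \<open>r\<close> inverts \<open>y^(b-2)\<close>, so this element is its own inverse. The proof
  moves it through \<open>relB\<close> in two ways.\<close>

lemma q_dvd_b: "q dvd 2 * (b - 2)"
proof -
  have "yp (b - 2) \<otimes> (yp (- 1) \<otimes> xp 1) = yp (- 1) \<otimes> (yp (b - 2) \<otimes> xp 1)"
    by (simp add: normal_form_simps)
  also have "\<dots> = yp (- 1) \<otimes> xp 1 \<otimes> yp (b - 2)" using Y_comm by (simp add: normal_form_simps)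
  also have "\<dots> = xp i \<otimes> (r \<otimes> yp (j + (b - 2)))" using relB by (simp add: normal_form_simps)
  finally have "xp i \<otimes> (r \<otimes> yp (j + (b - 2))) = yp (b - 2) \<otimes> xp i \<otimes> (r \<otimes> yp j)"
    using relB by (simp add: normal_form_simps)
  also have "\<dots> = xp i \<otimes> (r \<otimes> yp (j - (b - 2)))"
    using Y_comm by (simp add: normal_form_simps algebra_simps)
  finally show ?thesis using normal_form_r_unique(2) by fastforce
qed

text \<open>Multiply \<open>relB\<close> by \<open>y^(-1)\<close> on the left and evaluate the left
  side by \<open>relC\<close>.\<close>

lemma Y_Xi: "yp (- 1) \<otimes> xp i = xp a \<otimes> (r \<otimes> yp (j - b))"
proof -
  have "yp (- 1) \<otimes> (yp (- 1) \<otimes> xp 1) = yp (- 1) \<otimes> (xp i \<otimes> (r \<otimes> yp j))" using relB by simp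
  then have "xp a \<otimes> yp b \<otimes> (yp (- j) \<otimes> r) = yp (- 1) \<otimes> (xp i \<otimes> (r \<otimes> yp j)) \<otimes> (yp (- j) \<otimes> r)"
    using relC by (simp add: normal_form_simps)
  then show ?thesis by (simp add: normal_form_simps)
qed

lemma Y_Xi': "yp (- 1) \<otimes> xp (- i) = xp (- 1) \<otimes> (r \<otimes> yp (- j))"
proof -
  have "r \<otimes> (yp 1 \<otimes> (yp (- 1) \<otimes> xp 1)) \<otimes> (yp (- j)) = r \<otimes> (yp 1 \<otimes> (xp i \<otimes> (r \<otimes> yp j))) \<otimes> yp (- j)"
    using relB by simp
  then have "r \<otimes> (xp 1 \<otimes> yp (- j)) = r \<otimes> (yp 1 \<otimes> (xp i \<otimes> r))" by (simp add: normal_form_simps)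
  then show ?thesis by (simp add: m_assoc x y r r_X r_Y X_r' r_Y' rr r_r')
qed

text \<open>If \<open>x^i = x^(-i)\<close>, then \<open>Y_Xi\<close> and \<open>Y_Xi'\<close> give
  two normal forms of the same element.\<close>

lemma double_i:
  assumes "p dvd 2 * i"
  shows "p dvd a + 1" "q dvd 2 * j - b"
proof -
  have "xp i = xp (- i)" using assms by (intro xp_cong) simp
  then have "xp a \<otimes> (r \<otimes> yp (j - b)) = xp (- 1) \<otimes> (r \<otimes> yp (- j))"
    using Y_Xi Y_Xi' by simp
  from normal_form_r_unique[OF this] show "p dvd a + 1" "q dvd 2 * j - b" by (simp_all add: algebra_simps)
qed

text \<open>The element \<open>y^j x\<close> is computed twice: once from \<open>Y_Xi\<close>, using
  that \<open>y\<close> inverts \<open>x^(i-2)\<close>, and once from \<open>relC\<close>, using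
  that \<open>x\<close> inverts \<open>y^(j+2)\<close>.\<close>

lemma dvd_a_j: "p dvd 2 * (a - 1)" "q dvd 2 * (j - 1)"
proof -
  have "yp (- 1) \<otimes> (xp (i - 2) \<otimes> yp 1) \<otimes> yp (- 1) = yp (- 1) \<otimes> (yp 1 \<otimes> xp (2 - i)) \<otimes> yp (- 1)"
    using inverted_x by (simp add: inverted_powers_def)
  then have inv_c: "yp (- 1) \<otimes> xp (i - 2) = xp (2 - i) \<otimes> yp (- 1)" by (simp add: normal_form_simps)
  have "yp (- 1) \<otimes> xp i = yp (- 1) \<otimes> xp (i - 2) \<otimes> xp 2" by (simp add: normal_form_simps)
  also have "\<dots> = xp (2 - i) \<otimes> (yp (- 1) \<otimes> xp 1) \<otimes> xp 1" unfolding inv_c by (simp add: normal_form_simps)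
  also have "\<dots> = xp 2 \<otimes> (r \<otimes> (yp j \<otimes> xp 1))" unfolding relB by (simp add: normal_form_simps)
  finally have "r \<otimes> (xp (- 2) \<otimes> (xp a \<otimes> (r \<otimes> yp (j - b)))) = r \<otimes> (xp (- 2) \<otimes> (xp 2 \<otimes> (r \<otimes> (yp j \<otimes> xp 1))))"
    using Y_Xi by simp
  then have "xp (2 - a) \<otimes> yp (j - b) = yp j \<otimes> xp 1" by (simp add: normal_form_simps)
  also have "\<dots> = yp (- 2) \<otimes> (yp (j + 2) \<otimes> xp 1)" by (simp add: normal_form_simps)
  also have "\<dots> = yp (- 2) \<otimes> xp 1 \<otimes> yp (- (j + 2))"
    using inverted_y by (simp add: inverted_powers_def normal_form_simps)
  also have "\<dots> = xp a \<otimes> yp (b - j - 2)" unfolding relC by (simp add: normal_form_simps algebra_simps)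
  finally have *: "p dvd 2 - a - a" "q dvd j - b - (b - j - 2)" using normal_form_unique by blast+
  \<comment> \<open>The exponents of \<open>y\<close> only give \<open>2 * (j - b + 1) = 0\<close>
    modulo \<open>q\<close>; adding \<open>2 * (b - 2)\<close>, a multiple of \<open>q\<close>,
    eliminates \<open>b\<close>.\<close>
  from *(1) show "p dvd 2 * (a - 1)" by (simp add: dvd_diff_commute algebra_simps)
  have "2 * (j - 1) = j - b - (b - j - 2) + 2 * (b - 2)" by simp
  then show "q dvd 2 * (j - 1)" using *(2) q_dvd_b by (metis dvd_add)
qed

lemma in_inverted_y:
  assumes "k \<in> inverted_powers y (xp 1)" "l \<in> inverted_powers y (xp 1)" "gcd k l dvd m"
  shows "m \<in> inverted_powers y (xp 1)"
  using inverted_powers_gcd[OF y _ assms] x by simp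

lemma q_inverted: "q \<in> inverted_powers y (xp 1)"
  using ord_y[of q] ord_y[of "- q"] by (simp add: inverted_powers_def x)

text \<open>Both \<open>j + 2\<close> and \<open>q\<close> are inverted exponents. Their gcd divides
  6 because \<open>q\<close> divides \<open>2 * (j - 1)\<close> and
  \<open>6 = 2 * (j + 2) - 2 * (j - 1)\<close>.\<close>

lemma six_inverted: "6 \<in> inverted_powers y (xp 1)"
proof (rule in_inverted_y[OF inverted_y q_inverted])
  have "gcd (j + 2) q dvd 2 * (j + 2) - 2 * (j - 1)"
    using dvd_a_j(2) by (meson dvd_diff dvd_mult dvd_trans gcd_dvd1 gcd_dvd2)
  then show "gcd (j + 2) q dvd 6" by (simp add: algebra_simps)
qed

text \<open>For even \<open>j\<close>, \<open>x\<close> would invert \<open>y^j\<close>, and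
  \<open>relB\<close> would give a normal form of \<open>y^(-1)\<close> that contains
  \<open>r\<close>. For odd \<open>j\<close>, \<open>2\<close> and \<open>j + 2\<close> are coprime,
  so \<open>x\<close> would invert \<open>y\<close> itself and \<open>y^(-1) x\<close> would have a
  normal form without \<open>r\<close>, against \<open>relB\<close>.\<close>

lemma two_not_inverted: "2 \<notin> inverted_powers y (xp 1)"
proof
  assume 2: "2 \<in> inverted_powers y (xp 1)"
  show False
  proof (cases "even j")
    case True
    then have "- j \<in> inverted_powers y (xp 1)" using in_inverted_y[OF 2 2] by simp
    then have "yp (- j) \<otimes> xp 1 = xp 1 \<otimes> yp j" by (simp add: inverted_powers_def)
    from inv_flip(2)[OF this] have j: "yp j \<otimes> xp (- 1) = xp (- 1) \<otimes> yp (- j)" by simp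
    have "yp (- 1) = yp (- 1) \<otimes> xp 1 \<otimes> xp (- 1)" by (simp add: normal_form_simps)
    also have "\<dots> = xp i \<otimes> (r \<otimes> (yp j \<otimes> xp (- 1)))" unfolding relB by (simp add: normal_form_simps)
    also have "\<dots> = xp (i + 1) \<otimes> (r \<otimes> yp (- j))" unfolding j by (simp add: normal_form_simps)
    finally show False using normal_form_disjoint[of "i + 1" "- j" 0 "- 1"] y by (metis int_pow_0 int_pow_closed l_one)
  next
    case False
    then have "gcd 2 (j + 2) dvd - 1" by (simp add: coprime_iff_gcd_eq_1[symmetric])
    then have "- 1 \<in> inverted_powers y (xp 1)" by (rule in_inverted_y[OF 2 inverted_y])
    then show False using relB normal_form_disjoint by (simp add: inverted_powers_def)
  qed
qed

text \<open>The gcd of 6 and \<open>q\<close> is an inverted exponent; if 3 did not divide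
  \<open>q\<close>, it would divide 2.\<close>

lemma three_dvd_q: "3 dvd q"
proof (rule ccontr)
  assume "\<not> 3 dvd q"
  then have "coprime (3::int) q" by (simp add: prime_imp_coprime)
  then have "coprime (gcd 6 q) 3" by (metis coprime_commute coprime_divisors dvd_refl gcd_dvd2)
  moreover have "gcd 6 q dvd 3 * 2" by (metis gcd_dvd1 mult_2_right numeral_Bit0)
  ultimately have "gcd 6 q dvd 2" by (metis coprime_dvd_mult_right_iff)
  then show False using in_inverted_y[OF six_inverted q_inverted] two_not_inverted by blast
qed

text \<open>With \<open>x^a = x\<close>, applying \<open>relC\<close> twice gives
  \<open>y^(-4) x = x y^(2b) = x y^4\<close>. Then -4 and 6 are inverted exponents, and so is their
  gcd 2.\<close>

lemma not_dvd_a: "\<not> p dvd a - 1"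
proof
  assume "p dvd a - 1"
  then have C: "yp (- 2) \<otimes> xp 1 = xp 1 \<otimes> yp b" using relC xp_cong by metis
  have b: "yp (2 * b) = yp 4" using q_dvd_b by (intro yp_cong) (simp add: algebra_simps)
  have "yp (- 4) \<otimes> xp 1 = yp (- 2) \<otimes> (yp (- 2) \<otimes> xp 1)" by (simp add: normal_form_simps)
  also have "\<dots> = yp (- 2) \<otimes> xp 1 \<otimes> yp b" by (simp only: C) (simp add: m_assoc x y flip: C)
  also have "\<dots> = xp 1 \<otimes> yp 4" unfolding C by (simp add: normal_form_simps b)
  finally have "- 4 \<in> inverted_powers y (xp 1)" by (simp add: inverted_powers_def)
  moreover have "gcd (- 4) 6 dvd - 4 + (6 :: int)" by (rule dvd_add) simp_all
  ultimately show False using in_inverted_y[OF _ six_inverted, of "- 4" 2] two_not_inverted by simp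
qed

lemma p_dvd_a: "even p" "p dvd a - 1 - p div 2"
  using dvd_double_not_dvd[OF dvd_a_j(1) not_dvd_a] .

text \<open>If \<open>x\<close> inverts \<open>y^(j-1)\<close>, then \<open>y^(-j) x\<close> can be
  computed from \<open>relB\<close> as well as from \<open>relB_rev\<close>, and the exponents
  \<open>i\<close> and \<open>-i\<close> of \<open>x\<close> agree modulo \<open>p\<close>.\<close>

lemma j_inverted_imp:
  assumes "j - 1 \<in> inverted_powers y (xp 1)"
  shows "p = 4" "p dvd i - 2" "q dvd b - 2"
proof -
  have "gcd (j - 1) (j - 1) dvd - (j - 1)" by (simp only: dvd_minus_iff gcd_dvd1)
  then have "- (j - 1) \<in> inverted_powers y (xp 1)" by (rule in_inverted_y[OF assms assms])
  then have j: "yp (- (j - 1)) \<otimes> xp 1 = xp 1 \<otimes> yp (j - 1)" by (simp add: inverted_powers_def)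
  have "xp (- i) \<otimes> (r \<otimes> yp 1) = yp (- 1) \<otimes> (yp (- (j - 1)) \<otimes> xp 1)"
    using relB_rev by (simp add: normal_form_simps)
  also have "\<dots> = yp (- 1) \<otimes> xp 1 \<otimes> yp (j - 1)" unfolding j by (simp add: normal_form_simps)
  also have "\<dots> = xp i \<otimes> (r \<otimes> yp (j + (j - 1)))" unfolding relB by (simp add: normal_form_simps)
  finally have "p dvd - i - i" by (rule normal_form_r_unique)
  then have i: "p dvd 2 * i" by (metis diff_minus_eq_add dvd_minus_iff minus_diff_eq mult_2)
  note ab = double_i[OF i]
  \<comment> \<open>The congruences \<open>a = -1\<close> and \<open>2 * a = 2\<close> modulo
    \<open>p\<close> together leave only divisors of 4.\<close>
  have "p dvd 2 * (a + 1) - 2 * (a - 1)"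
    using ab(1) dvd_a_j(1) by (metis dvd_diff dvd_mult)
  then have "p dvd 4" by (simp add: algebra_simps)
  then have "p \<le> 4" by (simp add: zdvd_imp_le)
  have "\<not> p dvd 2"
  proof
    assume "p dvd 2"
    then have "p dvd a + 1 - 2" using ab(1) by (rule dvd_diff[rotated])
    then show False using not_dvd_a by simp
  qed
  then have "p \<noteq> 1" "p \<noteq> 2" by auto
  moreover have "p \<noteq> 3" using \<open>p dvd 4\<close> by auto
  ultimately show p: "p = 4" using p_pos \<open>p \<le> 4\<close> by linarith
  \<comment> \<open>If \<open>x^i\<close> were trivial, \<open>relB\<close> would read
    \<open>x = r y^(j-1)\<close>.\<close>
  have "\<not> p dvd i"
  proof
    assume "p dvd i"
    then have "xp i = \<one>" by (simp add: ord_x)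
    then have "yp 1 \<otimes> (yp (- 1) \<otimes> xp 1) = yp 1 \<otimes> (r \<otimes> yp j)" using relB by (simp add: r y)
    then have "xp 1 = r \<otimes> yp (j - 1)" by (simp add: normal_form_simps)
    then show False using normal_form_disjoint[of 0 "j - 1" 1 0] by (simp add: x y r)
  qed
  then show "p dvd i - 2" using dvd_double_not_dvd(2)[OF i] p by simp
  have "q dvd 2 * j - b - 2 * (j - 1)" using ab(2) dvd_a_j(2) by (rule dvd_diff)
  then show "q dvd b - 2" by (simp add: dvd_diff_commute)
qed

text \<open>Since multiples of \<open>q\<close> are inverted exponents, \<open>j\<close> is not 1
  modulo \<open>q\<close>, which leaves \<open>j = 1 + q / 2\<close>. The other claims hold because
  their failure would make \<open>j - 1\<close> an inverted exponent.\<close>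

lemma j_not_inverted_imp:
  assumes nin: "j - 1 \<notin> inverted_powers y (xp 1)"
  shows "q dvd b - 2" "6 dvd q" "odd (q div 6)" "q dvd j - 1 - q div 2"
proof -
  have "\<not> q dvd j - 1" using nin in_inverted_y[OF q_inverted q_inverted] by auto
  note j = dvd_double_not_dvd[OF dvd_a_j(2) this]
  show "q dvd j - 1 - q div 2" by (fact j)
  show six: "6 dvd q"
    using j(1) three_dvd_q divides_mult[of 2 q 3] by simp
  show "q dvd b - 2"
  proof (rule ccontr)
    assume nb: "\<not> q dvd b - 2"
    \<comment> \<open>Now \<open>b - 2\<close> and \<open>j - 1\<close> are both
      \<open>q / 2\<close> modulo \<open>q\<close>. So \<open>y^(j-1) = y^(b-2)\<close> commutes
      with \<open>x\<close> and is its own inverse, hence is inverted by \<open>x\<close>.\<close>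
    have "q dvd (j - 1 - q div 2) - (b - 2 - q div 2)"
      using j(2) dvd_double_not_dvd(2)[OF q_dvd_b nb] by (rule dvd_diff)
    then have jb: "q dvd (j - 1) - (b - 2)" by (simp add: algebra_simps)
    have "yp (b - 2) = yp (- (b - 2))" using q_dvd_b by (intro yp_cong) (simp add: algebra_simps)
    then have "b - 2 \<in> inverted_powers y (xp 1)" using Y_comm by (simp add: inverted_powers_def)
    moreover have "gcd (b - 2) q dvd (j - 1) - (b - 2) + (b - 2)"
      using jb by (meson dvd_add dvd_trans gcd_dvd1 gcd_dvd2)
    ultimately have "j - 1 \<in> inverted_powers y (xp 1)"
      using in_inverted_y[OF _ q_inverted] by simp
    then show False using nin by simp
  qed
  show "odd (q div 6)"
  proof
    assume even: "even (q div 6)"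
    obtain k where k: "q = 6 * (2 * k)" using even six by (metis dvd_div_mult_self dvdE mult.commute)
    then obtain n where n: "j - 1 - 6 * k = 12 * k * n" using j(2) by auto
    \<comment> \<open>When \<open>q\<close> is a multiple of 12, \<open>j - 1\<close> is a multiple
      of 6. Then \<open>j + 2\<close> is odd, and the inverted exponents include 3 and therefore
      \<open>j - 1\<close>.\<close>
    have "gcd (j + 2) 6 dvd 3"
    proof -
      have "j + 2 = 2 * (3 * k + 6 * k * n + 1) + 1" using n by (simp add: algebra_simps)
      then have "odd (j + 2)" by simp
      then have "odd (gcd (j + 2) 6)" by (meson dvd_trans gcd_dvd1)
      then have "coprime (gcd (j + 2) 6) 2" by simp
      moreover have "gcd (j + 2) 6 dvd 2 * 3" by (metis gcd_dvd2 mult_2 numeral_Bit0)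
      ultimately show ?thesis by (metis coprime_dvd_mult_right_iff)
    qed
    moreover have "3 dvd j - 1"
    proof -
      have "j - 1 = 3 * (2 * k + 4 * k * n)" using n by (simp add: algebra_simps)
      then show ?thesis by simp
    qed
    ultimately show False using in_inverted_y[OF inverted_y six_inverted] nin dvd_trans by blast
  qed
qed

text \<open>Here \<open>relC\<close> reads \<open>y^(-2) x = x x^h y^2\<close>. Using it three times
  in \<open>y^(-6) x = x y^6\<close> gives \<open>(x^h y^2)^3 = y^6\<close>; inverting and
  conjugating by \<open>r\<close> brings this to the stated form.\<close>

lemma Y4_Xh:
  assumes p: "p = 2 * h" and a: "p dvd a - 1 - h" and b: "q dvd b - 2"
  shows "yp 4 \<otimes> xp h = xp h \<otimes> (yp 2 \<otimes> (xp h \<otimes> yp 2))"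
proof -
  have neg: "xp (- h) = xp h" using p by (intro xp_cong) simp
  have E: "yp (- 2) \<otimes> xp 1 = xp (1 + h) \<otimes> yp 2"
    using relC xp_cong[of a "1 + h"] yp_cong[OF b] a by (simp add: algebra_simps)
  \<comment> \<open>The free exponent \<open>k\<close> and tail \<open>z\<close> let the same rule
    act at \<open>y^(-6)\<close>, \<open>y^(-4)\<close> and \<open>y^(-2)\<close> in turn.\<close>
  have E': "yp k \<otimes> (xp 1 \<otimes> z) = yp (k + 2) \<otimes> (xp 1 \<otimes> (xp h \<otimes> (yp 2 \<otimes> z)))"
    if z: "z \<in> carrier G" for k z
  proof -
    have "yp (k + 2) \<otimes> (yp (- 2) \<otimes> xp 1) \<otimes> z = yp (k + 2) \<otimes> (xp (1 + h) \<otimes> yp 2) \<otimes> z"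
      using E by simp
    then show ?thesis using z by (simp add: normal_form_simps)
  qed
  have "gcd 6 6 dvd (- 6 :: int)" by simp
  then have "- 6 \<in> inverted_powers y (xp 1)" by (rule in_inverted_y[OF six_inverted six_inverted])
  then have "yp (- 6) \<otimes> (xp 1 \<otimes> \<one>) = xp 1 \<otimes> yp 6" by (simp add: inverted_powers_def x)
  then have "xp 1 \<otimes> (xp h \<otimes> (yp 2 \<otimes> (xp h \<otimes> (yp 2 \<otimes> (xp h \<otimes> yp 2))))) = xp 1 \<otimes> yp 6"
    using E'[OF one_closed, of "-6"] E'[of _ "-4"] E'[of _ "-2"] by (simp add: x y)
  then have "xp (- h - 1) \<otimes> (xp 1 \<otimes> (xp h \<otimes> (yp 2 \<otimes> (xp h \<otimes> (yp 2 \<otimes> (xp h \<otimes> yp 2)))))) \<otimes> yp (- 2)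
      = xp (- h - 1) \<otimes> (xp 1 \<otimes> yp 6) \<otimes> yp (- 2)" by simp
  then have "yp 2 \<otimes> (xp h \<otimes> (yp 2 \<otimes> xp h)) = xp h \<otimes> yp 4" by (simp add: normal_form_simps neg)
  then have "inv (yp 2 \<otimes> (xp h \<otimes> (yp 2 \<otimes> xp h))) = inv (xp h \<otimes> yp 4)" by simp
  then have "xp (- h) \<otimes> (yp (- 2) \<otimes> (xp (- h) \<otimes> yp (- 2))) = yp (- 4) \<otimes> xp (- h)"
    by (simp add: x y inv_mult_group int_pow_neg m_assoc)
  then have "r \<otimes> (xp (- h) \<otimes> (yp (- 2) \<otimes> (xp (- h) \<otimes> yp (- 2)))) \<otimes> r = r \<otimes> (yp (- 4) \<otimes> xp (- h)) \<otimes> r"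
    by simp
  then show ?thesis by (simp add: m_assoc x y r rr r_X r_Y X_r' r_Y')
qed

end

section \<open>The permutation that \<open>y\<close> induces on the vertices
  \<open>x^k v\<close>\<close>

locale Delta_rotation_action = Delta_rotation_pair +
  fixes act :: "'a \<Rightarrow> 'v \<Rightarrow> 'v" and v :: 'v
  assumes act_mult: "g \<in> carrier G \<Longrightarrow> h \<in> carrier G \<Longrightarrow> act (g \<otimes> h) v = act g (act h v)"
    and act_r: "act r v = v" and act_y: "act y v = v"
    and act_x: "act (xp k) v = v \<Longrightarrow> p dvd k"
    and act_total: "g \<in> carrier G \<Longrightarrow> \<exists>k. act g v = act (xp k) v"
begin

lemma act_cong:
  assumes "act h v = act h' v" "g \<in> carrier G" "h \<in> carrier G" "h' \<in> carrier G"
  shows "act (g \<otimes> h) v = act (g \<otimes> h') v"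
  using assms by (simp add: act_mult)

lemma act_one: "act \<one> v = v"
  using act_mult[OF r r] by (simp add: rr act_r)

lemma act_yp: "act (yp k) v = v"
proof (induction k rule: int_induct[where k = 0])
  case base
  show ?case by (simp add: act_one)
next
  case (step1 k)
  have "yp (k + 1) = yp k \<otimes> y" by (simp add: gen_pow_1 flip: Y_Y)
  then show ?case using act_mult[of "yp k" y] y step1 act_y by simp
next
  case (step2 k)
  have "yp k = yp (k - 1) \<otimes> y" using Y_Y[of "k - 1" 1] by (simp add: gen_pow_1)
  then show ?case using act_mult[of "yp (k - 1)" y] y step2 act_y by simp
qed

lemma act_mult_yp: "g \<in> carrier G \<Longrightarrow> act (g \<otimes> yp k) v = act g v"
  and act_mult_r: "g \<in> carrier G \<Longrightarrow> act (g \<otimes> r) v = act g v"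
  by (simp_all add: act_mult y r act_yp act_r)

lemma act_xp_eq: "act (xp k) v = act (xp l) v \<longleftrightarrow> p dvd k - l"
proof
  assume "act (xp k) v = act (xp l) v"
  then have "act (xp (- l) \<otimes> xp k) v = act (xp (- l) \<otimes> xp l) v"
    by (rule act_cong) (simp_all add: x)
  then show "p dvd k - l" using act_x[of "k - l"] by (simp add: normal_form_simps act_one)
qed (simp add: xp_cong)

text \<open>A relation rather than a function on exponents, because \<open>l\<close> is determined
  by \<open>k\<close> only modulo \<open>p\<close>.\<close>

definition y_maps :: "int \<Rightarrow> int \<Rightarrow> bool" where
  "y_maps k l \<longleftrightarrow> act (yp 1 \<otimes> xp k) v = act (xp l) v"

lemma y_maps_total: "\<exists>l. y_maps k l"
  unfolding y_maps_def by (rule act_total) (simp add: x y)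

lemma y_maps_cong: "\<lbrakk>y_maps k l; p dvd k - k'; p dvd l - l'\<rbrakk> \<Longrightarrow> y_maps k' l'"
  unfolding y_maps_def using xp_cong by metis

lemma y_maps_det: "\<lbrakk>y_maps k l; y_maps k l'\<rbrakk> \<Longrightarrow> p dvd l - l'"
  unfolding y_maps_def by (simp flip: act_xp_eq)

lemma y_maps_iff: "y_maps k l \<longleftrightarrow> act (yp (- 1) \<otimes> xp l) v = act (xp k) v"
proof
  assume "y_maps k l"
  then have "act (yp (- 1) \<otimes> (yp 1 \<otimes> xp k)) v = act (yp (- 1) \<otimes> xp l) v"
    unfolding y_maps_def by (rule act_cong) (simp_all add: x y)
  then show "act (yp (- 1) \<otimes> xp l) v = act (xp k) v" by (simp add: normal_form_simps)
next
  assume "act (yp (- 1) \<otimes> xp l) v = act (xp k) v"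
  then have "act (yp 1 \<otimes> (yp (- 1) \<otimes> xp l)) v = act (yp 1 \<otimes> xp k) v"
    by (rule act_cong) (simp_all add: x y)
  then show "y_maps k l" unfolding y_maps_def by (simp add: normal_form_simps)
qed

lemma y_maps_inj: "\<lbrakk>y_maps k l; y_maps k' l\<rbrakk> \<Longrightarrow> p dvd k - k'"
  unfolding y_maps_iff by (simp flip: act_xp_eq)

text \<open>Conjugation by \<open>r\<close> fixes \<open>v\<close> and inverts \<open>x\<close> and
  \<open>y\<close>, so \<open>y^(-1)\<close> takes the vertex of \<open>-k\<close> to that of
  \<open>-l\<close>.\<close>

lemma y_maps_neg:
  assumes "y_maps k l"
  shows "y_maps (- l) (- k)"
proof -
  have "act (r \<otimes> (yp (- 1) \<otimes> xp l)) v = act (r \<otimes> xp k) v"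
    using assms unfolding y_maps_iff by (rule act_cong) (simp_all add: x y r)
  then show ?thesis unfolding y_maps_def
    using act_mult_r[of "yp 1 \<otimes> xp (- l)"] act_mult_r[of "xp (- k)"]
    by (simp add: r_X r_Y' x y r m_assoc)
qed

lemma y_maps_shift:
  assumes c: "c \<in> inverted_powers x (yp 1)" and kl: "y_maps k l"
  shows "y_maps (k + c) (l - c)"
proof -
  have "gcd c c dvd - c" by simp
  then have "- c \<in> inverted_powers x (yp 1)"
    using inverted_powers_gcd[OF x _ c c] y by simp
  then have "xp (- c) \<otimes> yp 1 = yp 1 \<otimes> xp c" by (simp add: inverted_powers_def)
  then have "yp 1 \<otimes> xp (k + c) = xp (- c) \<otimes> (yp 1 \<otimes> xp k)"
    by (simp add: x y add.commute flip: m_assoc) (simp add: normal_form_simps)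
  moreover have "act (xp (- c) \<otimes> (yp 1 \<otimes> xp k)) v = act (xp (- c) \<otimes> xp l) v"
    using kl unfolding y_maps_def by (rule act_cong) (simp_all add: x y)
  ultimately show ?thesis by (simp add: y_maps_def normal_form_simps)
qed

text \<open>Apply \<open>y x\<close> to the vertex \<open>y x^k v\<close> and simplify with
  \<open>y x y = x^(-1)\<close>.\<close>

lemma y_maps_swap:
  assumes "y_maps k l"
  shows "y_maps (l + 1) (k - 1)"
proof -
  have "act (yp 1 \<otimes> xp 1 \<otimes> (yp 1 \<otimes> xp k)) v = act (yp 1 \<otimes> xp 1 \<otimes> xp l) v"
    using assms unfolding y_maps_def by (rule act_cong) (simp_all add: x y)
  moreover have "yp 1 \<otimes> xp 1 \<otimes> (yp 1 \<otimes> xp k) = yp 1 \<otimes> (xp 1 \<otimes> yp 1) \<otimes> xp k"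
    by (simp add: x y m_assoc)
  ultimately show ?thesis unfolding Y_X' by (simp add: y_maps_def normal_form_simps add.commute)
qed

lemma y_maps_step:
  assumes "y_maps k l" "act (yp n \<otimes> xp l) v = w"
  shows "act (yp (n + 1) \<otimes> xp k) v = w"
proof -
  have "act (yp n \<otimes> (yp 1 \<otimes> xp k)) v = act (yp n \<otimes> xp l) v"
    using assms(1) unfolding y_maps_def by (rule act_cong) (simp_all add: x y)
  then show ?thesis using assms(2) by (simp add: normal_form_simps)
qed

text \<open>As \<open>x\<close> inverts \<open>y^6\<close>, moving \<open>y^6\<close> past
  \<open>x^k\<close> leaves \<open>y^6\<close> or \<open>y^(-6)\<close>, both of which fix
  \<open>v\<close>. The sign alternates, so the induction carries both.\<close>

lemma act_Y6: "act (yp 6 \<otimes> xp k) v = act (xp k) v"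
proof -
  have "gcd 6 6 dvd (- 6 :: int)" by simp
  then have m6: "yp (- 6) \<otimes> xp 1 = xp 1 \<otimes> yp 6"
    using in_inverted_y[OF six_inverted six_inverted] by (simp add: inverted_powers_def)
  have p6: "yp 6 \<otimes> xp 1 = xp 1 \<otimes> yp (- 6)"
    using six_inverted by (simp add: inverted_powers_def)
  have step: "act (yp s \<otimes> xp (e + k)) v = act (xp (e + k)) v"
    if s: "yp s \<otimes> xp e = xp e \<otimes> yp (- s)" and IH: "act (yp (- s) \<otimes> xp k) v = act (xp k) v" for s e k
  proof -
    have "yp s \<otimes> xp (e + k) = yp s \<otimes> xp e \<otimes> xp k" by (simp add: normal_form_simps)
    also have "\<dots> = xp e \<otimes> (yp (- s) \<otimes> xp k)" unfolding s by (simp add: x y m_assoc)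
    finally show ?thesis
      using act_cong[OF IH, of "xp e"] by (simp add: x y X_X)
  qed
  have "act (yp 6 \<otimes> xp k) v = act (xp k) v \<and> act (yp (- 6) \<otimes> xp k) v = act (xp k) v"
  proof (induction k rule: int_induct[where k = 0])
    case base
    show ?case by (simp add: x y act_yp act_one)
  next
    case (step1 k)
    then show ?case using step[of 6 1 k] step[of "- 6" 1 k] p6 m6 by (simp add: add.commute)
  next
    case (step2 k)
    then show ?case
      using step[of 6 "- 1" k] step[of "- 6" "- 1" k] inv_flip(2)[OF p6] inv_flip(2)[OF m6] by simp
  qed
  then show ?thesis ..
qed

text \<open>Modulo \<open>p\<close>, the map \<open>y\<close> permutes exponents in the cycle
  \<open>i+1\<close>, \<open>h\<close>, \<open>-(i+1)\<close>, \<open>A\<close>, \<open>B\<close>,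
  \<open>C\<close>. Its symmetry under \<open>y_maps_neg\<close> together with \<open>Y4_Xh\<close>
  gives \<open>A = i+1\<close> and \<open>2 * A + h = 0\<close>, so \<open>h\<close> is even. A
  second argument, shifting by \<open>i - 2\<close>, shows that 4 divides
  \<open>i - 2\<close>.\<close>

lemma quarter_p:
  assumes p: "p = 2 * h" and a: "p dvd a - 1 - h" and b: "q dvd b - 2"
  obtains m n where "p = 4 * m" "odd m" "i + 1 = m * n" "4 dvd m * n - 3"
proof -
  let ?I = "inverted_powers x (yp 1)"
  have h_pos: "h > 0" using p p_pos by simp
  then have nh: "\<not> p dvd h" using p zdvd_not_zless[of h p] by simp
  have "act (yp (- 1) \<otimes> xp i) v = act (xp a \<otimes> (r \<otimes> yp (j - b))) v" unfolding Y_Xi ..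
  also have "\<dots> = act (xp a) v" by (simp add: x y r act_mult_yp act_mult_r flip: m_assoc)
  finally have "y_maps a i" unfolding y_maps_iff .
  \<comment> \<open>The swapped pair is \<open>(i + 1, a - 1)\<close>, and \<open>a - 1 = h\<close>
    modulo \<open>p\<close>; reflecting it gives the next link of the cycle.\<close>
  from y_maps_swap[OF this] have m1: "y_maps (i + 1) h"
    using y_maps_cong[of "i + 1" "a - 1" "i + 1" h] a by simp
  from y_maps_neg[OF this] have m2: "y_maps h (- (i + 1))"
    using y_maps_cong[of "- h" _ h "- (i + 1)"] p by (simp add: dvd_diff_commute)
  obtain A where m3: "y_maps (- (i + 1)) A" using y_maps_total by blast
  obtain B where m4: "y_maps A B" using y_maps_total by blast
  obtain C where m5: "y_maps B C" using y_maps_total by blast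
  obtain D where m6: "y_maps C D" using y_maps_total by blast
  \<comment> \<open>The exponent is left as a sum so that each \<open>y_maps_step\<close> matches
    \<open>n + 1\<close>. Six links return to the start by \<open>act_Y6\<close>, which closes the
    cycle.\<close>
  have Y6: "act (yp (0 + 1 + 1 + 1 + 1 + 1 + 1) \<otimes> xp (i + 1)) v = act (xp D) v"
    by (intro y_maps_step[OF m1] y_maps_step[OF m2] y_maps_step[OF m3] y_maps_step[OF m4]
        y_maps_step[OF m5] y_maps_step[OF m6]) (simp add: x)
  then have "p dvd D - (i + 1)" using act_Y6[of "i + 1"] act_xp_eq by (simp add: dvd_diff_commute)
  then have "y_maps C (i + 1)" using y_maps_cong[OF m6, of C] by simp
  moreover from y_maps_neg[OF m3] have "y_maps (- A) (i + 1)" by (simp add: add.commute)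
  ultimately have CA: "p dvd C - - A" by (rule y_maps_inj)
  \<comment> \<open>Both sides of \<open>Y4_Xh\<close> are evaluated at \<open>v\<close>: the left
    one gives the exponent \<open>C\<close>, the right one \<open>h + A\<close>. With
    \<open>C = -A\<close> this yields \<open>2 * A + h = 0\<close>.\<close>
  have Y4: "act (yp (0 + 1 + 1 + 1 + 1) \<otimes> xp h) v = act (xp C) v"
    by (intro y_maps_step[OF m2] y_maps_step[OF m3] y_maps_step[OF m4] y_maps_step[OF m5]) (simp add: x)
  have Y2: "act (yp (0 + 1 + 1) \<otimes> xp h) v = act (xp A) v"
    by (intro y_maps_step[OF m2] y_maps_step[OF m3]) (simp add: x)
  have "act (xp C) v = act (xp h \<otimes> (yp 2 \<otimes> (xp h \<otimes> yp 2))) v"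
    using Y4 Y4_Xh[OF p a b] by simp
  also have "\<dots> = act (xp h \<otimes> (yp 2 \<otimes> xp h)) v"
    by (simp add: x y act_mult_yp flip: m_assoc)
  also have "\<dots> = act (xp h \<otimes> xp A) v"
    using Y2 by (intro act_cong) (simp_all add: x y)
  finally have CA': "p dvd C - (h + A)" by (simp add: normal_form_simps flip: act_xp_eq)
  have "p dvd (C - - A) - (C - (h + A))" using CA CA' by (rule dvd_diff)
  then have Ah: "p dvd 2 * A + h" by (simp add: algebra_simps)
  from m5 have "y_maps B (- A)" using y_maps_cong CA by simp
  then have BB: "p dvd B - - B" using y_maps_neg[OF m4] by (rule y_maps_inj)
  \<comment> \<open>The exponent 0 is fixed by \<open>y\<close>, so \<open>B = 0\<close> would force
    \<open>C\<close>, \<open>A\<close> and then \<open>h\<close> to vanish modulo \<open>p\<close>.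
    As \<open>B = -B\<close>, this leaves \<open>B = h\<close>.\<close>
  have "\<not> p dvd B"
  proof
    assume B: "p dvd B"
    have "y_maps 0 0" by (simp add: y_maps_def x y act_yp act_one)
    moreover have "y_maps 0 C" using y_maps_cong[OF m5, of 0 C] B by simp
    ultimately have "p dvd 0 - C" by (rule y_maps_det)
    then have C: "p dvd C" by simp
    then have "p dvd A" using CA by (simp add: dvd_add_right_iff)
    then have "p dvd h" using Ah by (simp add: dvd_add_right_iff)
    then show False using nh by simp
  qed
  then have "p dvd B - h" using dvd_double_not_dvd(2)[of p B] BB p by simp
  then have "y_maps A h" using y_maps_cong[OF m4, of A h] by simp
  then have Ai: "p dvd A - (i + 1)" using m1 by (rule y_maps_inj)
  then have "p dvd (2 * A + h) - 2 * (A - (i + 1))" using Ah by (metis dvd_diff dvd_mult)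
  also have "(2 * A + h) - 2 * (A - (i + 1)) = 2 * (i + 1) + h" by simp
  finally obtain k where "2 * (i + 1) + h = p * k" by (rule dvdE)
  then have k: "2 * (i + 1) + h = 2 * h * k" using p by simp
  then have "h = 2 * (h * k - (i + 1))" by (simp add: algebra_simps)
  then obtain m where m: "h = 2 * m" by blast
  define n where "n = 2 * k - 1"
  have n: "i + 1 = m * n" using k m by (simp add: n_def algebra_simps)
  have p4: "p = 4 * m" using p m by simp
  have p_I: "p \<in> ?I"
    using ord_x[of p] ord_x[of "- p"] by (simp add: inverted_powers_def y)
  have in_I: "l \<in> ?I" if "gcd (i - 2) p dvd l" for l
    using inverted_powers_gcd[OF x _ inverted_x p_I that] y by simp
  have "y_maps (- (i + 1)) (i + 1)" using y_maps_cong[OF m3, of "- (i + 1)" "i + 1"] Ai by simp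
  from y_maps_shift[OF inverted_x this] have m33: "y_maps (- 3) 3" by simp
  have "- (i - 2) \<in> ?I" by (rule in_I) (simp only: dvd_minus_iff gcd_dvd1)
  from y_maps_shift[OF this m1] have m3h: "y_maps 3 (h + (i - 2))" by (simp add: algebra_simps)
  \<comment> \<open>Shifting the pair \<open>(-3, 3)\<close> by 6 would send 3 to -3; compared with
    \<open>m3h\<close> this makes 4 divide \<open>2 + n\<close>, although \<open>n\<close> is
    odd.\<close>
  have not6: "\<not> gcd (i - 2) p dvd 6"
  proof
    assume "gcd (i - 2) p dvd 6"
    from y_maps_shift[OF in_I[OF this] m33] have "y_maps 3 (- 3)" by simp
    from y_maps_det[OF m3h this] have "p dvd (h + (i + 1))" by (simp add: algebra_simps)
    then have "p dvd m * (2 + n)" unfolding n m by (simp add: algebra_simps)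
    then have "m * 4 dvd m * (2 + n)" using p4 by (simp add: mult.commute)
    then have "4 dvd 2 + n" using p4 p_pos by simp
    then show False unfolding n_def by presburger
  qed
  \<comment> \<open>The difference is \<open>4 * (i + 1) - 4 * (i - 2) = 12\<close>. A divisor of 12
    that does not divide 6 is a multiple of 4.\<close>
  have "gcd (i - 2) p dvd p * n - 4 * (i - 2)"
    by (intro dvd_diff dvd_mult2[OF gcd_dvd2] dvd_mult[OF gcd_dvd1])
  also have "p * n = 4 * (i + 1)" unfolding p4 n by simp
  finally have "gcd (i - 2) p dvd 12" by simp
  then obtain t where t: "12 = gcd (i - 2) p * t" by blast
  have "odd t"
  proof
    assume "even t"
    then obtain t' where "t = 2 * t'" by (rule evenE)
    then have "6 = gcd (i - 2) p * t'" using t by (simp add: mult.commute)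
    then show False using not6 dvdI by blast
  qed
  then have "coprime 4 t" using coprime_mult_left_iff[of 2 2 t] by simp
  moreover have "4 dvd gcd (i - 2) p * t" by (simp flip: t)
  ultimately have "4 dvd gcd (i - 2) p" by (simp add: coprime_dvd_mult_left_iff)
  then have "4 dvd i - 2" by simp
  also have "i - 2 = m * n - 3" using n by simp
  finally have "4 dvd m * n - 3" .
  moreover have "odd (m * n)"
  proof
    assume "even (m * n)"
    moreover have "even (m * n - 3)" using \<open>4 dvd m * n - 3\<close> by (rule dvd_trans[rotated]) simp
    ultimately show False by simp
  qed
  ultimately show thesis using that[OF p4 _ n] by simp
qed

end

section \<open>Automorphisms of polyhedra\<close>

lemma card_2_fixed:
  assumes "card A = 2" "f ` A \<subseteq> A" "inj_on f A" "a \<in> A" "f a = a" "b \<in> A"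
  shows "f b = b"
proof -
  obtain s t where "A = {s, t}" "s \<noteq> t" using assms(1) by (meson card_2_iff)
  then show ?thesis using assms(2-) by (auto simp: inj_on_def)
qed

section \<open>Incidence, flags and vertex-figures\<close>

locale abstract_polyhedron =
  fixes P :: "'a ranked_poset"
  assumes polyhedron: "polyhedron P"
begin

abbreviation leq :: "'a \<Rightarrow> 'a \<Rightarrow> bool" (infix "\<preceq>" 50) where
  "x \<preceq> y \<equiv> (x, y) \<in> le P"

lemma leq_elems: "x \<preceq> y \<Longrightarrow> x \<in> elems P \<and> y \<in> elems P"
  and leq_refl: "x \<in> elems P \<Longrightarrow> x \<preceq> x"
  and leq_trans: "x \<preceq> y \<Longrightarrow> y \<preceq> z \<Longrightarrow> x \<preceq> z"
proof -
  have po: "partial_order_on (elems P) (le P)" using polyhedron by (simp add: polyhedron_def)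
  show "x \<preceq> y \<Longrightarrow> x \<in> elems P \<and> y \<in> elems P" "x \<in> elems P \<Longrightarrow> x \<preceq> x"
    using po by (auto simp: partial_order_on_def preorder_on_def refl_on_def)
  have "trans (le P)" using po by (simp add: partial_order_on_def preorder_on_def)
  then show "x \<preceq> y \<Longrightarrow> y \<preceq> z \<Longrightarrow> x \<preceq> z" by (meson transD)
qed

lemma rk_less: "x \<preceq> y \<Longrightarrow> x \<noteq> y \<Longrightarrow> rk P x < rk P y"
  using polyhedron unfolding polyhedron_def by blast

lemma rk_le_2: "x \<in> elems P \<Longrightarrow> rk P x \<le> 2"
  using polyhedron unfolding polyhedron_def by fastforce

lemma leq_same_rk: "x \<preceq> y \<Longrightarrow> rk P y \<le> rk P x \<Longrightarrow> x = y"
  using rk_less by fastforce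

lemma elems_cases:
  assumes "x \<in> elems P"
  obtains "x \<in> vertices P" | "x \<in> edges P" | "x \<in> faces P"
  using rk_le_2[OF assms] assms unfolding of_rank_def by fastforce

lemma of_rankD: "x \<in> of_rank P n \<Longrightarrow> x \<in> elems P \<and> rk P x = n"
  by (simp add: of_rank_def)

lemma card_vertices_edge: "e \<in> edges P \<Longrightarrow> card {v \<in> vertices P. v \<preceq> e} = 2"
  and card_faces_edge: "e \<in> edges P \<Longrightarrow> card {f \<in> faces P. e \<preceq> f} = 2"
  using polyhedron unfolding polyhedron_def by blast+

lemma edge_has_vertex: "e \<in> edges P \<Longrightarrow> \<exists>v\<in>vertices P. v \<preceq> e"
  using card_vertices_edge[of e] by (metis (mono_tags, lifting) card.empty empty_Collect_eq zero_neq_numeral)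

lemma edge_has_face: "e \<in> edges P \<Longrightarrow> \<exists>f\<in>faces P. e \<preceq> f"
  using card_faces_edge[of e] by (metis (mono_tags, lifting) card.empty empty_Collect_eq zero_neq_numeral)

text \<open>One inclusion is the flag axiom. Conversely, distinct comparable elements have distinct
  ranks, so nothing can extend a chain that already contains the ranks 0, 1 and 2.\<close>

lemma flags_eq:
  "flags P = {{v, e, f} | v e f. v \<in> vertices P \<and> e \<in> edges P \<and> f \<in> faces P \<and> v \<preceq> e \<and> e \<preceq> f}"
proof (intro equalityI subsetI)
  fix C assume C: "C \<in> flags P"
  have "\<forall>\<Phi>\<in>flags P. \<exists>v\<in>vertices P. \<exists>e\<in>edges P. \<exists>f\<in>faces P. \<Phi> = {v, e, f}"
    using polyhedron unfolding polyhedron_def by (elim conjE)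
  then obtain v e f where vef: "v \<in> vertices P" "e \<in> edges P" "f \<in> faces P" "C = {v, e, f}"
    using C by meson
  have "pred_on.chain (elems P) (\<lambda>x y. x \<preceq> y) C"
    using C by (simp add: flags_def pred_on.maxchain_def)
  then have "v \<preceq> e \<or> e \<preceq> v \<or> v = e" "e \<preceq> f \<or> f \<preceq> e \<or> e = f"
    using vef(4) by (auto simp: pred_on.chain_def)
  then have "v \<preceq> e" "e \<preceq> f"
    using vef leq_same_rk[of e v] leq_same_rk[of f e] by (auto simp: of_rank_def)
  then show "C \<in> {{v, e, f} | v e f. v \<in> vertices P \<and> e \<in> edges P \<and> f \<in> faces P \<and> v \<preceq> e \<and> e \<preceq> f}"
    using vef by blast
next
  fix C assume "C \<in> {{v, e, f} | v e f. v \<in> vertices P \<and> e \<in> edges P \<and> f \<in> faces P \<and> v \<preceq> e \<and> e \<preceq> f}"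
  then obtain v e f where C: "C = {v, e, f}" and vef: "v \<in> vertices P" "e \<in> edges P" "f \<in> faces P"
    and le: "v \<preceq> e" "e \<preceq> f" by blast
  have rk: "rk P v = 0" "rk P e = 1" "rk P f = 2" and el: "v \<in> elems P" "e \<in> elems P" "f \<in> elems P"
    using vef by (auto simp: of_rank_def)
  have "pred_on.chain (elems P) (\<lambda>x y. x \<preceq> y) C"
  proof (rule pred_on.chainI)
    show "C \<subseteq> elems P" using C el by simp
    show "(\<lambda>x y. x \<preceq> y)\<^sup>=\<^sup>= c d \<or> (\<lambda>x y. x \<preceq> y)\<^sup>=\<^sup>= d c" if "c \<in> C" "d \<in> C" for c d
      using that le leq_trans[OF le] unfolding C by blast
  qed
  moreover have False if S: "pred_on.chain (elems P) (\<lambda>x y. x \<preceq> y) S" and CS: "C \<subset> S" for S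
  proof -
    obtain z where z: "z \<in> S" "z \<notin> C" using CS by blast
    have zel: "z \<in> elems P" using S z(1) by (auto simp: pred_on.chain_def)
    have cmp: "z \<preceq> c \<or> c \<preceq> z" if "c \<in> C" for c
      using S CS z that unfolding pred_on.chain_def by blast
    have "rk P z \<noteq> rk P c" if "c \<in> C" for c
      using cmp[OF that] that z(2) leq_same_rk[of z c] leq_same_rk[of c z] by auto
    then have "rk P z \<noteq> 0" "rk P z \<noteq> 1" "rk P z \<noteq> 2" using rk C by force+
    then show False using rk_le_2[OF zel] by linarith
  qed
  ultimately show "C \<in> flags P" unfolding flags_def pred_on.maxchain_def by blast
qed

text \<open>A face with nothing below it would by itself be a maximal chain, contradicting the shape
  of flags.\<close>

lemma face_has_vertex:
  assumes f: "f \<in> faces P"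
  shows "\<exists>v\<in>vertices P. v \<preceq> f"
proof -
  have rkf: "rk P f = 2" and fe: "f \<in> elems P" using f by (auto simp: of_rank_def)
  have "\<exists>z. z \<preceq> f \<and> z \<noteq> f"
  proof (rule ccontr)
    assume no: "\<nexists>z. z \<preceq> f \<and> z \<noteq> f"
    have "False" if S: "pred_on.chain (elems P) (\<lambda>x y. x \<preceq> y) S" and CS: "{f} \<subset> S" for S
    proof -
      obtain z where z: "z \<in> S" "z \<noteq> f" using CS by blast
      then have "z \<in> elems P" "z \<preceq> f \<or> f \<preceq> z" using S CS by (auto simp: pred_on.chain_def)
      then show False using no z(2) rk_le_2[of z] leq_same_rk[of f z] rkf by auto
    qed
    then have "{f} \<in> flags P"
      using fe by (auto simp: flags_def pred_on.maxchain_def pred_on.chain_def)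
    then obtain v e f' where "{f} = {v, e, f'}" "v \<in> vertices P"
      unfolding flags_eq by blast
    then have "f \<in> vertices P" by auto
    then show False using rkf by (simp add: of_rank_def)
  qed
  then obtain z where z: "z \<preceq> f" "z \<noteq> f" by blast
  have "z \<in> elems P" using leq_elems[OF z(1)] by simp
  then show ?thesis
  proof (cases rule: elems_cases)
    case 1
    then show ?thesis using z by blast
  next
    case 2
    then show ?thesis using edge_has_vertex leq_trans z(1) by blast
  next
    case 3
    then show ?thesis using rk_less[OF z] rkf by (simp add: of_rank_def)
  qed
qed

text \<open>Everything is transported along the isomorphism with the incidence poset: edges at
  \<open>v\<close> become graph vertices and faces at \<open>v\<close> become graph edges. The two
  edges between \<open>v\<close> and a face are the two ends of a graph edge.\<close>

lemma vertex_figure: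
  assumes v: "v \<in> vertices P"
  shows vertex_has_edge: "\<exists>e\<in>edges P. v \<preceq> e"
    and card_edges_between: "\<And>f. f \<in> faces P \<Longrightarrow> v \<preceq> f \<Longrightarrow> card {e \<in> edges P. v \<preceq> e \<and> e \<preceq> f} = 2"
    and vertex_figure_connected: "\<And>e e'. e \<in> edges P \<Longrightarrow> v \<preceq> e \<Longrightarrow> e' \<in> edges P \<Longrightarrow> v \<preceq> e' \<Longrightarrow>
      (e, e') \<in> {(d, d'). d \<in> edges P \<and> v \<preceq> d \<and> d' \<in> edges P \<and> v \<preceq> d' \<and>
        (\<exists>f\<in>faces P. d \<preceq> f \<and> d' \<preceq> f)}\<^sup>*"
proof -
  define U where "U = {x \<in> elems P. v \<preceq> x \<and> x \<noteq> v}"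
  have "\<exists>(V :: 'a set) (E :: 'a set) ends.
        multigraph V E ends \<and> graph_connected V E ends \<and> two_regular V E ends \<and>
        posets_isomorphic U (le P) (incidence_carrier V E) (incidence_order V E ends)"
    using polyhedron v unfolding U_def by (simp add: polyhedron_def)
  then obtain V E :: "'a set" and ends where
    graph: "multigraph V E ends" "graph_connected V E ends" "two_regular V E ends"
    and iso: "posets_isomorphic U (le P) (incidence_carrier V E) (incidence_order V E ends)"
    by blast
  obtain \<phi> where \<phi>: "bij_betw \<phi> U (incidence_carrier V E)"
    and \<phi>_le: "\<And>x y. x \<in> U \<Longrightarrow> y \<in> U \<Longrightarrow> x \<preceq> y \<longleftrightarrow> (\<phi> x, \<phi> y) \<in> incidence_order V E ends"
    using iso unfolding posets_isomorphic_def by blast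
  have car: "incidence_carrier V E = Inl ` V \<union> Inr ` E"
    by (simp add: incidence_carrier_def Plus_def)
  have inc: "(Inl u, Inr k) \<in> incidence_order V E ends \<longleftrightarrow> u \<in> V \<and> k \<in> E \<and> u \<in> ends k"
    "(Inr k, s) \<in> incidence_order V E ends \<Longrightarrow> s = Inr k" for u k s
    by (auto simp: incidence_order_def)
  have inj: "inj_on \<phi> U" and img: "\<phi> ` U = Inl ` V \<union> Inr ` E"
    using \<phi> car by (auto simp: bij_betw_def)
  have rkv: "rk P v = 0" using v by (simp add: of_rank_def)
  have edge_U: "e \<in> U" if "e \<in> edges P" "v \<preceq> e" for e
    using that rkv by (auto simp: U_def of_rank_def)
  have face_U: "f \<in> U" if "f \<in> faces P" "v \<preceq> f" for f
    using that rkv by (auto simp: U_def of_rank_def)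
  have U_cases: "x \<in> edges P \<or> x \<in> faces P" if "x \<in> U" for x
  proof -
    have "rk P x > 0" using that rk_less[of v x] by (auto simp: U_def)
    then show ?thesis using elems_cases[of x] that by (auto simp: U_def of_rank_def)
  qed
  \<comment> \<open>The isomorphism is not assumed to respect ranks. An edge lies strictly below a
    face, whereas \<open>Inr\<close> elements are maximal; conversely, 2-regularity puts every
    \<open>Inl\<close> element strictly below another one.\<close>
  have edge_Inl: "\<exists>u\<in>V. \<phi> e = Inl u" if e: "e \<in> edges P" "v \<preceq> e" for e
  proof (rule ccontr)
    assume "\<not> (\<exists>u\<in>V. \<phi> e = Inl u)"
    then obtain k where k: "\<phi> e = Inr k" using edge_U[OF e] img by blast
    obtain f where f: "f \<in> faces P" "e \<preceq> f" using edge_has_face e(1) by blast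
    then have fU: "f \<in> U" using face_U leq_trans[OF e(2)] by blast
    then have "(Inr k, \<phi> f) \<in> incidence_order V E ends" using \<phi>_le[OF edge_U[OF e] fU] f(2) k by simp
    then have "\<phi> f = Inr k" by (rule inc(2))
    then have "\<phi> f = \<phi> e" using k by simp
    then have "f = e" using inj_onD[OF inj _ fU edge_U[OF e]] by blast
    then show False using e f by (simp add: of_rank_def)
  qed
  have face_Inr: "\<exists>k\<in>E. \<phi> f = Inr k" if f: "f \<in> faces P" "v \<preceq> f" for f
  proof (rule ccontr)
    assume "\<not> (\<exists>k\<in>E. \<phi> f = Inr k)"
    then obtain u where u: "\<phi> f = Inl u" "u \<in> V" using face_U[OF f] img by blast
    have "card {k \<in> E. u \<in> ends k} = 2" using graph(3) u(2) by (simp add: two_regular_def)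
    then obtain k where k: "k \<in> E" "u \<in> ends k"
      by (metis (mono_tags, lifting) card.empty empty_Collect_eq zero_neq_numeral)
    then obtain z where z: "z \<in> U" "\<phi> z = Inr k" using img by (metis UnCI imageE imageI)
    then have "f \<preceq> z" using \<phi>_le[OF face_U[OF f] z(1)] inc(1) u k by simp
    moreover have "f \<noteq> z" using u z by auto
    ultimately have "rk P f < rk P z" by (rule rk_less)
    then show False using rk_le_2[of z] z(1) f(1) by (auto simp: U_def of_rank_def)
  qed
  define \<psi> where "\<psi> = inv_into U \<phi>"
  have \<psi>: "\<psi> s \<in> U" "\<phi> (\<psi> s) = s" if "s \<in> Inl ` V \<union> Inr ` E" for s
    using that img by (auto simp: \<psi>_def inv_into_into f_inv_into_f)
  have \<psi>\<phi>: "\<psi> (\<phi> x) = x" if "x \<in> U" for x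
    using that inj by (simp add: \<psi>_def)
  have \<psi>_edge: "\<psi> (Inl u) \<in> edges P" "v \<preceq> \<psi> (Inl u)" if "u \<in> V" for u
  proof -
    have s: "Inl u \<in> Inl ` V \<union> Inr ` E" using that by blast
    show "v \<preceq> \<psi> (Inl u)" using \<psi>(1)[OF s] by (simp add: U_def)
    then show "\<psi> (Inl u) \<in> edges P"
      using U_cases[OF \<psi>(1)[OF s]] face_Inr[of "\<psi> (Inl u)"] \<psi>(2)[OF s] by auto
  qed
  have \<psi>_face: "\<psi> (Inr k) \<in> faces P" if "k \<in> E" for k
  proof -
    have s: "Inr k \<in> Inl ` V \<union> Inr ` E" using that by blast
    then have "v \<preceq> \<psi> (Inr k)" using \<psi>(1)[OF s] by (simp add: U_def)
    then show "\<psi> (Inr k) \<in> faces P"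
      using U_cases[OF \<psi>(1)[OF s]] edge_Inl[of "\<psi> (Inr k)"] \<psi>(2)[OF s] by auto
  qed
  have \<psi>_le: "\<psi> (Inl u) \<preceq> \<psi> (Inr k)" if "u \<in> V" "k \<in> E" "u \<in> ends k" for u k
    using that \<phi>_le[OF \<psi>(1) \<psi>(1)] \<psi>(2) inc(1) by simp
  have "V \<noteq> {}" using graph(2) by (simp add: graph_connected_def)
  then show "\<exists>e\<in>edges P. v \<preceq> e" using \<psi>_edge by blast
  show "card {e \<in> edges P. v \<preceq> e \<and> e \<preceq> f} = 2" if f: "f \<in> faces P" "v \<preceq> f" for f
  proof -
    let ?D = "{e \<in> edges P. v \<preceq> e \<and> e \<preceq> f}"
    obtain k where k: "k \<in> E" "\<phi> f = Inr k" using face_Inr[OF f] by blast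
    have ends: "ends k \<subseteq> V" "card (ends k) = 2" using graph(1) k(1) by (auto simp: multigraph_def)
    have img_D: "\<phi> ` ?D = Inl ` ends k"
    proof (intro equalityI subsetI)
      fix s assume "s \<in> \<phi> ` ?D"
      then obtain e where e: "e \<in> edges P" "v \<preceq> e" "e \<preceq> f" "s = \<phi> e" by blast
      obtain u where u: "u \<in> V" "\<phi> e = Inl u" using edge_Inl e by blast
      then have "u \<in> ends k" using \<phi>_le[OF edge_U[OF e(1,2)] face_U[OF f]] e(3) k inc(1) by simp
      then show "s \<in> Inl ` ends k" using e u by simp
    next
      fix s :: "'a + 'a" assume "s \<in> Inl ` ends k"
      then obtain u where u: "u \<in> ends k" "u \<in> V" "s = Inl u" using ends by blast
      have "\<psi> (Inr k) = f" using \<psi>\<phi>[OF face_U[OF f]] k by simp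
      then have "\<psi> s \<in> ?D" using \<psi>_edge \<psi>_le u k by auto
      moreover have "s \<in> Inl ` V \<union> Inr ` E" using u by blast
      then have "s = \<phi> (\<psi> s)" using \<psi>(2) by simp
      ultimately show "s \<in> \<phi> ` ?D" by (rule rev_image_eqI)
    qed
    have "inj_on \<phi> ?D" using inj by (rule inj_on_subset) (use edge_U in blast)
    then have "card ?D = card (\<phi> ` ?D)" by (simp only: card_image)
    also have "\<dots> = card (ends k)" unfolding img_D by (rule card_image) simp
    finally show ?thesis using ends(2) by simp
  qed
  fix e e' assume e: "e \<in> edges P" "v \<preceq> e" and e': "e' \<in> edges P" "v \<preceq> e'"
  obtain u u' where u: "u \<in> V" "\<phi> e = Inl u" and u': "u' \<in> V" "\<phi> e' = Inl u'"
    using edge_Inl e e' by meson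
  have "(u, u') \<in> {(s, t). \<exists>k\<in>E. s \<in> ends k \<and> t \<in> ends k}\<^sup>*"
    using graph(2) u u' by (simp add: graph_connected_def)
  then have "(\<psi> (Inl u), \<psi> (Inl u')) \<in> {(d, d'). d \<in> edges P \<and> v \<preceq> d \<and> d' \<in> edges P \<and> v \<preceq> d' \<and>
        (\<exists>f\<in>faces P. d \<preceq> f \<and> d' \<preceq> f)}\<^sup>*"
  proof (induction rule: rtrancl_induct)
    case (step s t)
    then obtain k where k: "k \<in> E" "s \<in> ends k" "t \<in> ends k" by blast
    then have "s \<in> V" "t \<in> V" using graph(1) by (auto simp: multigraph_def)
    then have "(\<psi> (Inl s), \<psi> (Inl t)) \<in> {(d, d'). d \<in> edges P \<and> v \<preceq> d \<and> d' \<in> edges P \<and> v \<preceq> d' \<and>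
        (\<exists>f\<in>faces P. d \<preceq> f \<and> d' \<preceq> f)}"
      using \<psi>_edge \<psi>_le[OF _ k(1)] \<psi>_face[OF k(1)] k(2,3) by blast
    with step.IH show ?case by (rule rtrancl_into_rtrancl)
  qed simp
  then show "(e, e') \<in> {(d, d'). d \<in> edges P \<and> v \<preceq> d \<and> d' \<in> edges P \<and> v \<preceq> d' \<and>
        (\<exists>f\<in>faces P. d \<preceq> f \<and> d' \<preceq> f)}\<^sup>*"
    using \<psi>\<phi>[OF edge_U[OF e]] \<psi>\<phi>[OF edge_U[OF e']] u u' by simp
qed

section \<open>Automorphisms preserve rank and are determined by the image of a flag\<close>

lemma aut_elems: "\<gamma> \<in> carrier (aut_group P) \<Longrightarrow> x \<in> elems P \<Longrightarrow> \<gamma> x \<in> elems P"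
  and aut_inj: "\<gamma> \<in> carrier (aut_group P) \<Longrightarrow> inj_on \<gamma> (elems P)"
  and aut_surj: "\<gamma> \<in> carrier (aut_group P) \<Longrightarrow> \<gamma> ` elems P = elems P"
  and aut_extensional: "\<gamma> \<in> carrier (aut_group P) \<Longrightarrow> \<gamma> \<in> extensional (elems P)"
  by (auto simp: aut_group_def Bij_def bij_betw_def)

lemma aut_leq:
  assumes "\<gamma> \<in> carrier (aut_group P)" "x \<in> elems P" "y \<in> elems P"
  shows "\<gamma> x \<preceq> \<gamma> y \<longleftrightarrow> x \<preceq> y"
  using assms by (simp add: aut_group_def)

lemma aut_mult:
  assumes "g \<in> carrier (aut_group P)" "h \<in> carrier (aut_group P)" "x \<in> elems P"
  shows "(g \<otimes>\<^bsub>aut_group P\<^esub> h) x = g (h x)"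
  using assms by (simp add: aut_group_def BijGroup_def compose_eq)

lemma aut_one: "\<one>\<^bsub>aut_group P\<^esub> = (\<lambda>x\<in>elems P. x)"
  by (simp add: aut_group_def BijGroup_def)

text \<open>Automorphisms are only required to preserve the order. Describing ranks 0 and 2 as
  minimality and maximality makes them preserve rank, rank 1 being the remaining case.\<close>

lemma rk_0_iff:
  assumes x: "x \<in> elems P"
  shows "rk P x = 0 \<longleftrightarrow> \<not> (\<exists>z\<in>elems P. z \<preceq> x \<and> z \<noteq> x)"
proof
  assume "rk P x = 0"
  then show "\<not> (\<exists>z\<in>elems P. z \<preceq> x \<and> z \<noteq> x)" using rk_less[of _ x] by fastforce
next
  assume min: "\<not> (\<exists>z\<in>elems P. z \<preceq> x \<and> z \<noteq> x)"
  have "\<exists>v\<in>vertices P. v \<preceq> x"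
    using x
  proof (cases rule: elems_cases)
    case 1
    then show ?thesis using leq_refl x by blast
  qed (use edge_has_vertex face_has_vertex in blast)+
  then obtain v where "v \<in> vertices P" "v \<preceq> x" by blast
  then show "rk P x = 0" using min by (auto simp: of_rank_def)
qed

lemma rk_2_iff:
  assumes x: "x \<in> elems P"
  shows "rk P x = 2 \<longleftrightarrow> \<not> (\<exists>z\<in>elems P. x \<preceq> z \<and> z \<noteq> x)"
proof
  assume "rk P x = 2"
  then show "\<not> (\<exists>z\<in>elems P. x \<preceq> z \<and> z \<noteq> x)" using rk_less[of x] rk_le_2 by fastforce
next
  assume max: "\<not> (\<exists>z\<in>elems P. x \<preceq> z \<and> z \<noteq> x)"
  have "\<exists>f\<in>faces P. x \<preceq> f"
    using x
  proof (cases rule: elems_cases)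
    case 1
    then show ?thesis using vertex_has_edge edge_has_face leq_trans by meson
  next
    case 3
    then show ?thesis using leq_refl x by blast
  qed (use edge_has_face in blast)
  then obtain f where "f \<in> faces P" "x \<preceq> f" by blast
  then show "rk P x = 2" using max by (auto simp: of_rank_def)
qed

lemma aut_rk:
  assumes \<gamma>: "\<gamma> \<in> carrier (aut_group P)" and x: "x \<in> elems P"
  shows "rk P (\<gamma> x) = rk P x"
proof -
  have \<gamma>x: "\<gamma> x \<in> elems P" by (rule aut_elems[OF \<gamma> x])
  have iff: "(\<exists>z\<in>elems P. Q z) \<longleftrightarrow> (\<exists>z\<in>elems P. Q (\<gamma> z))" for Q
    using aut_surj[OF \<gamma>] by (metis (no_types, lifting) image_iff)
  have neq: "\<gamma> z \<noteq> \<gamma> x \<longleftrightarrow> z \<noteq> x" if "z \<in> elems P" for z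
    using inj_onD[OF aut_inj[OF \<gamma>] _ that x] by blast
  have "rk P (\<gamma> x) = 0 \<longleftrightarrow> rk P x = 0"
    unfolding rk_0_iff[OF x] rk_0_iff[OF \<gamma>x] iff[of "\<lambda>z. z \<preceq> \<gamma> x \<and> z \<noteq> \<gamma> x"]
    using aut_leq[OF \<gamma> _ x] neq by blast
  moreover have "rk P (\<gamma> x) = 2 \<longleftrightarrow> rk P x = 2"
    unfolding rk_2_iff[OF x] rk_2_iff[OF \<gamma>x] iff[of "\<lambda>z. \<gamma> x \<preceq> z \<and> z \<noteq> \<gamma> x"]
    using aut_leq[OF \<gamma> x] neq by blast
  ultimately show ?thesis using rk_le_2[OF x] rk_le_2[OF \<gamma>x] by linarith
qed

lemma aut_of_rank:
  "\<gamma> \<in> carrier (aut_group P) \<Longrightarrow> x \<in> of_rank P n \<Longrightarrow> \<gamma> x \<in> of_rank P n"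
  by (simp add: of_rank_def aut_elems aut_rk)

lemma aut_fixes_pair:
  assumes \<gamma>: "\<gamma> \<in> carrier (aut_group P)" and D: "card D = 2" "D \<subseteq> elems P"
    and closed: "\<And>x. x \<in> D \<Longrightarrow> \<gamma> x \<in> D" and xy: "x \<in> D" "\<gamma> x = x" "y \<in> D"
  shows "\<gamma> y = y"
proof (rule card_2_fixed[of D \<gamma> x y, OF D(1) _ _ xy])
  show "\<gamma> ` D \<subseteq> D" using closed by blast
  show "inj_on \<gamma> D" using aut_inj[OF \<gamma>] D(2) by (rule inj_on_subset)
qed

text \<open>Being fixed spreads along the connected vertex-figure by two-element sets: the faces
  containing an edge, and the edges at \<open>v\<close> in a face. An automorphism fixing one member
  of such an invariant pair fixes the other.\<close>

lemma aut_fixes_vertex_figure: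
  assumes \<gamma>: "\<gamma> \<in> carrier (aut_group P)"
    and flag: "v \<in> vertices P" "e \<in> edges P" "f \<in> faces P" "v \<preceq> e" "e \<preceq> f"
    and fixed: "\<gamma> v = v" "\<gamma> e = e" "\<gamma> f = f"
    and d: "d \<in> edges P" "v \<preceq> d"
  shows "\<gamma> d = d \<and> (\<forall>f\<in>faces P. d \<preceq> f \<longrightarrow> \<gamma> f = f)"
proof -
  have face_step: "\<gamma> f' = f'"
    if "d \<in> edges P" "\<gamma> d = d" "f \<in> faces P" "d \<preceq> f" "\<gamma> f = f" "f' \<in> faces P" "d \<preceq> f'" for d f f'
  proof (rule aut_fixes_pair[OF \<gamma> card_faces_edge[OF that(1)], where x = f])
    fix x assume "x \<in> {f \<in> faces P. d \<preceq> f}"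
    then show "\<gamma> x \<in> {f \<in> faces P. d \<preceq> f}"
      using aut_of_rank[OF \<gamma>] aut_leq[OF \<gamma>, of d x] that(1,2) of_rankD by auto
  qed (use that of_rankD in auto)
  have edge_step: "\<gamma> d' = d'"
    if "d \<in> edges P" "v \<preceq> d" "\<gamma> d = d" "f \<in> faces P" "d \<preceq> f" "\<gamma> f = f" "d' \<in> edges P" "v \<preceq> d'" "d' \<preceq> f"
    for d d' f
  proof (rule aut_fixes_pair[OF \<gamma> card_edges_between[OF flag(1) that(4)], where x = d])
    show "v \<preceq> f" using leq_trans[OF that(2,5)] .
    fix x assume "x \<in> {e \<in> edges P. v \<preceq> e \<and> e \<preceq> f}"
    then show "\<gamma> x \<in> {e \<in> edges P. v \<preceq> e \<and> e \<preceq> f}"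
      using aut_of_rank[OF \<gamma>] aut_leq[OF \<gamma>, of v x] aut_leq[OF \<gamma>, of x f] that(4,6) flag(1) fixed(1) of_rankD
      by auto
  qed (use that of_rankD in auto)
  let ?r = "{(d, d'). d \<in> edges P \<and> v \<preceq> d \<and> d' \<in> edges P \<and> v \<preceq> d' \<and>
        (\<exists>f\<in>faces P. d \<preceq> f \<and> d' \<preceq> f)}"
  have "(e, d) \<in> ?r\<^sup>*" using vertex_figure_connected[OF flag(1,2,4) d] .
  then show ?thesis
  proof (induction rule: rtrancl_induct)
    case base
    show ?case using face_step[OF flag(2) fixed(2) flag(3,5) fixed(3)] fixed(2) by blast
  next
    case (step d d')
    then obtain f' where d: "d \<in> edges P" "v \<preceq> d" "d' \<in> edges P" "v \<preceq> d'"
      and f': "f' \<in> faces P" "d \<preceq> f'" "d' \<preceq> f'" by blast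
    have "\<gamma> d = d" "\<gamma> f' = f'" using step.IH f' by auto
    then have "\<gamma> d' = d'" using edge_step[OF d(1,2) _ f'(1,2) _ d(3,4) f'(3)] by blast
    then show ?case using face_step[OF d(3) _ f'(1,3) \<open>\<gamma> f' = f'\<close>] by blast
  qed
qed

text \<open>Faces need not be connected in this notion of polyhedron, but vertex-figures are, so an
  automorphism fixing a flag fixes everything at its vertex, hence at every adjacent vertex.\<close>
lemma aut_fixes_flag:
  assumes \<gamma>: "\<gamma> \<in> carrier (aut_group P)"
    and flag: "v \<in> vertices P" "e \<in> edges P" "f \<in> faces P" "v \<preceq> e" "e \<preceq> f"
    and fixed: "\<gamma> v = v" "\<gamma> e = e" "\<gamma> f = f"
  shows "\<gamma> = \<one>\<^bsub>aut_group P\<^esub>"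
proof -
  let ?Q = "\<lambda>v. v \<in> vertices P \<and> \<gamma> v = v \<and>
    (\<forall>d\<in>edges P. v \<preceq> d \<longrightarrow> \<gamma> d = d \<and> (\<forall>f\<in>faces P. d \<preceq> f \<longrightarrow> \<gamma> f = f))"
  let ?r = "{(s, t). \<exists>e\<in>edges P. s \<in> {v \<in> vertices P. v \<preceq> e} \<and> t \<in> {v \<in> vertices P. v \<preceq> e}}"
  have conn: "graph_connected (vertices P) (edges P) (\<lambda>e. {v \<in> vertices P. v \<preceq> e})"
    using polyhedron unfolding polyhedron_def by (elim conjE)
  have Q: "?Q w" if w: "w \<in> vertices P" for w
  proof -
    have "(v, w) \<in> ?r\<^sup>*"
      using conn flag(1) w unfolding graph_connected_def by blast
    then show ?thesis
    proof (induction rule: rtrancl_induct)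
      case base
      show ?case using aut_fixes_vertex_figure[OF \<gamma> flag fixed] flag(1) fixed(1) by blast
    next
      case (step s t)
      then obtain d where d: "d \<in> edges P" "s \<preceq> d" "t \<preceq> d" and st: "s \<in> vertices P" "t \<in> vertices P"
        by blast
      have \<gamma>d: "\<gamma> d = d" using step.IH d by blast
      have "\<gamma> t = t"
      proof (rule aut_fixes_pair[OF \<gamma> card_vertices_edge[OF d(1)]])
        fix x assume "x \<in> {v \<in> vertices P. v \<preceq> d}"
        then show "\<gamma> x \<in> {v \<in> vertices P. v \<preceq> d}"
          using aut_of_rank[OF \<gamma>] aut_leq[OF \<gamma>, of x d] d(1) \<gamma>d of_rankD by auto
      next
        show "s \<in> {v \<in> vertices P. v \<preceq> d}" "\<gamma> s = s" "t \<in> {v \<in> vertices P. v \<preceq> d}"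
          using step.IH d st by blast+
      qed (use of_rankD in auto)
      moreover obtain f' where f': "f' \<in> faces P" "d \<preceq> f'" using edge_has_face d(1) by blast
      moreover have "\<gamma> f' = f'" using step.IH d f' by blast
      ultimately show ?case
        using aut_fixes_vertex_figure[OF \<gamma> st(2) d(1) f'(1) d(3) f'(2) _ \<gamma>d] st(2) by blast
    qed
  qed
  have edge: "\<gamma> d = d \<and> (\<forall>f\<in>faces P. d \<preceq> f \<longrightarrow> \<gamma> f = f)" if d: "d \<in> edges P" for d
    using edge_has_vertex[OF d] Q d by blast
  have "\<gamma> x = x" if "x \<in> elems P" for x
    using that
  proof (cases rule: elems_cases)
    case 1
    then show ?thesis using Q by blast
  next
    case 2
    then show ?thesis using edge by blast
  next
    case 3
    obtain w where w: "w \<in> vertices P" "w \<preceq> x" using face_has_vertex[OF 3] by blast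
    have "{e \<in> edges P. w \<preceq> e \<and> e \<preceq> x} \<noteq> {}"
      using card_edges_between[OF w(1) 3 w(2)] by (metis card.empty zero_neq_numeral)
    then show ?thesis using edge 3 by blast
  qed
  then show ?thesis
    using aut_extensional[OF \<gamma>] unfolding aut_one by (auto simp: extensional_def fun_eq_iff)
qed

text \<open>A flag determines its triple because the ranks tell its members apart, so flags are
  counted vertex by vertex. This converts tightness into the number of vertices.\<close>

lemma card_flags_eq:
  assumes fin: "finite (elems P)" and q: "\<And>v. v \<in> vertices P \<Longrightarrow> card {e \<in> edges P. v \<preceq> e} = q"
  shows "card (flags P) = card (vertices P) * (2 * q)"
proof -
  let ?S = "SIGMA v:vertices P. SIGMA e:{e \<in> edges P. v \<preceq> e}. {f \<in> faces P. e \<preceq> f}"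
  have fin': "finite (of_rank P n)" for n using fin by (simp add: of_rank_def)
  have "flags P = (\<lambda>(v, e, f). {v, e, f}) ` ?S"
    unfolding flags_eq by (auto simp: image_iff)
  moreover have "inj_on (\<lambda>(v, e, f). {v, e, f}) ?S"
  proof (rule inj_onI)
    fix s t assume st: "s \<in> ?S" "t \<in> ?S" "(\<lambda>(v, e, f). {v, e, f}) s = (\<lambda>(v, e, f). {v, e, f}) t"
    obtain v e f where s: "s = (v, e, f)" by (rule prod_cases3)
    obtain v' e' f' where t: "t = (v', e', f')" by (rule prod_cases3)
    have *: "{v, e, f} = {v', e', f'}" using st(3) s t by simp
    have "v \<in> vertices P" "e \<in> edges P" "f \<in> faces P" "v' \<in> vertices P" "e' \<in> edges P" "f' \<in> faces P"
      using st(1,2) s t by auto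
    then have "rk P v = 0" "rk P e = 1" "rk P f = 2" "rk P v' = 0" "rk P e' = 1" "rk P f' = 2"
      by (simp_all add: of_rank_def)
    then have "v \<noteq> e'" "v \<noteq> f'" "e \<noteq> v'" "e \<noteq> f'" "f \<noteq> v'" "f \<noteq> e'" by auto
    then show "s = t" unfolding s t using * by blast
  qed
  ultimately have "card (flags P) = card ?S" by (simp add: card_image)
  also have "\<dots> = (\<Sum>v\<in>vertices P. card (SIGMA e:{e \<in> edges P. v \<preceq> e}. {f \<in> faces P. e \<preceq> f}))"
    by (rule card_SigmaI) (use fin' in auto)
  also have "\<dots> = (\<Sum>v\<in>vertices P. 2 * q)"
  proof (rule sum.cong[OF HOL.refl])
    fix v assume v: "v \<in> vertices P"
    have "card (SIGMA e:{e \<in> edges P. v \<preceq> e}. {f \<in> faces P. e \<preceq> f}) =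
        (\<Sum>e\<in>{e \<in> edges P. v \<preceq> e}. card {f \<in> faces P. e \<preceq> f})"
      by (rule card_SigmaI) (use fin' in auto)
    also have "\<dots> = (\<Sum>e\<in>{e \<in> edges P. v \<preceq> e}. 2)"
      by (rule sum.cong) (auto simp: card_faces_edge)
    finally show "card (SIGMA e:{e \<in> edges P. v \<preceq> e}. {f \<in> faces P. e \<preceq> f}) = 2 * q"
      using q[OF v] by simp
  qed
  finally show ?thesis by simp
qed

end

section \<open>Relations in the automorphism group of a tight polyhedron\<close>

definition word_eval :: "('a, 'b) monoid_scheme \<Rightarrow> ('g \<Rightarrow> 'a) \<Rightarrow> 'g word \<Rightarrow> 'a" where
  "word_eval G \<phi> w =
     foldr (\<lambda>(g, s) z. (if s then \<phi> g else inv\<^bsub>G\<^esub> \<phi> g) \<otimes>\<^bsub>G\<^esub> z) w \<one>\<^bsub>G\<^esub>"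

context group
begin

lemma word_eval_simps:
  "word_eval G \<phi> [] = \<one>"
  "word_eval G \<phi> ((g, s) # w) = (if s then \<phi> g else inv \<phi> g) \<otimes> word_eval G \<phi> w"
  by (simp_all add: word_eval_def)

lemma word_eval_closed: "(\<And>g. \<phi> g \<in> carrier G) \<Longrightarrow> word_eval G \<phi> w \<in> carrier G"
  by (induction w) (auto simp: word_eval_simps)

lemma word_eval_append:
  "(\<And>g. \<phi> g \<in> carrier G) \<Longrightarrow> word_eval G \<phi> (u @ w) = word_eval G \<phi> u \<otimes> word_eval G \<phi> w"
proof (induction u)
  case (Cons l u)
  then show ?case
    using word_eval_closed[of \<phi> u] word_eval_closed[of \<phi> w]
    by (cases l) (auto simp: word_eval_simps m_assoc)
qed (simp add: word_eval_simps word_eval_closed)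

lemma word_eval_inv:
  "(\<And>g. \<phi> g \<in> carrier G) \<Longrightarrow> word_eval G \<phi> (word_inv w) = inv (word_eval G \<phi> w)"
proof (induction w)
  case (Cons l w)
  have "word_inv (l # w) = word_inv w @ [(fst l, \<not> snd l)]"
    by (cases l) (simp add: word_inv_def)
  then show ?case
    using Cons word_eval_closed[of \<phi> w]
    by (cases l) (auto simp: word_eval_append word_eval_simps inv_mult_group word_eval_closed)
qed (simp add: word_eval_simps word_inv_def)

lemma word_eval_pow:
  assumes \<phi>: "\<And>g. \<phi> g \<in> carrier G"
  shows "word_eval G \<phi> (word_pow w k) = word_eval G \<phi> w [^] k"
proof -
  have nat: "word_eval G \<phi> (concat (replicate n u)) = word_eval G \<phi> u [^] n" for u and n :: nat
  proof (induction n)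
    case (Suc n)
    then have "word_eval G \<phi> (concat (replicate (Suc n) u)) = word_eval G \<phi> u \<otimes> word_eval G \<phi> u [^] n"
      by (simp add: word_eval_append \<phi>)
    then show ?case
      using nat_pow_Suc2[of "word_eval G \<phi> u" n] word_eval_closed[of \<phi> u, OF \<phi>] by (simp only:)
  qed (simp add: word_eval_simps)
  have w: "word_eval G \<phi> w \<in> carrier G" using \<phi> by (rule word_eval_closed)
  have inv_w: "word_eval G \<phi> (word_inv w) = inv (word_eval G \<phi> w)" using \<phi> by (rule word_eval_inv)
  show ?thesis
  proof (cases k rule: int_cases2)
    case (nonneg n)
    then show ?thesis by (simp only: word_pow_def nat int_pow_int of_nat_0_le_iff if_True nat_int)
  next
    case (nonpos n)
    \<comment> \<open>The case \<open>n = 0\<close> is separate because \<open>word_pow\<close>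
      treats the exponent 0 in its nonnegative branch.\<close>
    show ?thesis
    proof (cases "n = 0")
      case False
      then have "word_pow w k = concat (replicate n (word_inv w))" by (simp add: nonpos word_pow_def)
      then show ?thesis by (simp only: nat inv_w nonpos int_pow_neg_int[OF w] nat_pow_inv[OF w])
    qed (simp add: nonpos word_pow_def word_eval_simps)
  qed
qed

end

lemma hom_presented_group_eval:
  assumes "group G" and h: "h \<in> hom (presented_group R) G"
    and \<phi>: "\<And>g. h (word_class R [(g, True)]) = \<phi> g"
  shows "h (word_class R w) = word_eval G \<phi> w"
proof -
  interpret group G by fact
  interpret h: group_hom "presented_group R" G h
    by (simp add: group_hom_def group_hom_axioms_def assms group_presented_group)
  have car: "word_class R u \<in> carrier (presented_group R)" for u
    by (simp add: presented_group_def)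
  have one: "h (word_class R []) = \<one>\<^bsub>G\<^esub>"
    using h.hom_one by (simp add: presented_group_def)
  have inv: "h (word_class R [(g, False)]) = inv\<^bsub>G\<^esub> \<phi> g" for g
  proof -
    have "word_class R ([(g, False)] @ [(g, True)]) = word_class R []"
      using word_equiv.cancel[of R "[]" g False "[]"] by (simp add: word_class_eq_iff)
    then have "h (word_class R [(g, False)]) \<otimes>\<^bsub>G\<^esub> \<phi> g = \<one>\<^bsub>G\<^esub>"
      using h.hom_mult[OF car car, of "[(g, False)]" "[(g, True)]"] one
      by (simp add: presented_group_mult \<phi>)
    then show ?thesis
      using h.hom_closed[OF car] \<phi> by (metis inv_equality)
  qed
  show ?thesis
  proof (induction w)
    case (Cons l w)
    have "h (word_class R (l # w)) = h (word_class R [l]) \<otimes>\<^bsub>G\<^esub> h (word_class R w)"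
      using h.hom_mult[OF car car, of "[l]" w] by (simp add: presented_group_mult)
    then show ?case using Cons inv \<phi> by (cases l) (auto simp: word_eval_simps)
  qed (simp add: one word_eval_simps)
qed

lemma hom_presented_group_relation:
  assumes "group G" "h \<in> hom (presented_group R) G" "\<And>g. h (word_class R [(g, True)]) = \<phi> g"
    and "(u, w) \<in> R"
  shows "word_eval G \<phi> u = word_eval G \<phi> w"
proof -
  have "word_equiv R u w" using word_equiv.rel[OF assms(4), of "[]" "[]"] by simp
  then have "word_class R u = word_class R w" by (simp add: word_class_eq_iff)
  then show ?thesis using hom_presented_group_eval[OF assms(1-3)] by metis
qed

lemma aut_group_is_Delta_relations:
  fixes G (structure)
  assumes "aut_group_is_Delta P \<rho> p q i j a b" and G_def: "G = aut_group P"
  shows "\<rho> 0 \<otimes> \<rho> 0 = \<one>" "\<rho> 1 \<otimes> \<rho> 1 = \<one>" "\<rho> 2 \<otimes> \<rho> 2 = \<one>"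
    "(\<rho> 0 \<otimes> \<rho> 2) \<otimes> (\<rho> 0 \<otimes> \<rho> 2) = \<one>"
    "sigma2 P \<rho> [^] (- 1 :: int) \<otimes> sigma1 P \<rho> =
       sigma1 P \<rho> [^] i \<otimes> (\<rho> 1 \<otimes> sigma2 P \<rho> [^] j)"
    "sigma2 P \<rho> [^] (- 2 :: int) \<otimes> sigma1 P \<rho> =
       sigma1 P \<rho> [^] a \<otimes> sigma2 P \<rho> [^] b"
proof -
  interpret group G unfolding G_def by (rule group_aut_group)
  let ?R = "Delta_relations p q i j a b"
  obtain h where h: "h \<in> hom (presented_group ?R) G"
    and h_gen: "h (word_class ?R (letter gx)) = \<rho> 0" "h (word_class ?R (letter gy)) = \<rho> 1"
      "h (word_class ?R (letter gz)) = \<rho> 2"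
    using assms(1) unfolding aut_group_is_Delta_def Delta_def Delta_gen_def G_def iso_def by blast
  define \<phi> where "\<phi> g = h (word_class ?R (letter g))" for g
  have \<phi>: "\<phi> gx = \<rho> 0" "\<phi> gy = \<rho> 1" "\<phi> gz = \<rho> 2" using h_gen by (simp_all add: \<phi>_def)
  have car: "\<phi> g \<in> carrier G" for g
    using h by (auto simp: \<phi>_def hom_def presented_group_def)
  then have \<rho>: "\<rho> 0 \<in> carrier G" "\<rho> 1 \<in> carrier G" "\<rho> 2 \<in> carrier G"
    using \<phi> by metis+
  have rel: "word_eval G \<phi> u = word_eval G \<phi> w" if "(u, w) \<in> ?R" for u w
    using hom_presented_group_relation[OF is_group h _ that] by (simp add: \<phi>_def)
  have ev: "word_eval G \<phi> (letter gx) = \<rho> 0" "word_eval G \<phi> (letter gy) = \<rho> 1"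
    "word_eval G \<phi> (letter gz) = \<rho> 2"
    using \<rho> by (simp_all add: word_eval_simps \<phi>)
  have s1: "word_eval G \<phi> s1 = sigma1 P \<rho>" and s2: "word_eval G \<phi> s2 = sigma2 P \<rho>"
    unfolding s1_def s2_def sigma1_def sigma2_def word_eval_append[of \<phi>, OF car] ev by (simp_all add: G_def)
  have sq: "z [^] (2::int) = z \<otimes> z" if "z \<in> carrier G" for z
    using int_pow_mult[OF that, of 1 1] that by (simp add: int_pow_1)
  have "word_eval G \<phi> (word_pow (letter g) 2) = \<one>" for g
    using rel[of "word_pow (letter g) 2" "[]"]
    by (cases g) (simp_all add: Delta_relations_def coxeter_relations_def word_eval_simps)
  then have g2: "\<phi> g \<otimes> \<phi> g = \<one>" for g
    using car sq[of "\<phi> g"] unfolding word_eval_pow[of \<phi>, OF car] by (auto simp: word_eval_simps)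
  show "\<rho> 0 \<otimes> \<rho> 0 = \<one>" "\<rho> 1 \<otimes> \<rho> 1 = \<one>" "\<rho> 2 \<otimes> \<rho> 2 = \<one>"
    using g2[of gx] g2[of gy] g2[of gz] \<phi> by simp_all
  have "word_eval G \<phi> (word_pow (letter gx @ letter gz) 2) = word_eval G \<phi> []"
    by (rule rel) (simp add: Delta_relations_def coxeter_relations_def)
  then show "(\<rho> 0 \<otimes> \<rho> 2) \<otimes> (\<rho> 0 \<otimes> \<rho> 2) = \<one>"
    unfolding word_eval_pow[of \<phi>, OF car] word_eval_append[of \<phi>, OF car] ev
    using sq \<rho> by (simp add: word_eval_simps)
  have "word_eval G \<phi> (word_pow s2 (- 1) @ s1) = word_eval G \<phi> (word_pow s1 i @ letter gy @ word_pow s2 j)"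
    by (rule rel) (simp add: Delta_relations_def)
  then show "sigma2 P \<rho> [^] (- 1 :: int) \<otimes> sigma1 P \<rho> =
      sigma1 P \<rho> [^] i \<otimes> (\<rho> 1 \<otimes> sigma2 P \<rho> [^] j)"
    unfolding word_eval_append[of \<phi>, OF car] word_eval_pow[of \<phi>, OF car] s1 s2 ev .
  have "word_eval G \<phi> (word_pow s2 (- 2) @ s1) = word_eval G \<phi> (word_pow s1 a @ word_pow s2 b)"
    by (rule rel) (simp add: Delta_relations_def)
  then show "sigma2 P \<rho> [^] (- 2 :: int) \<otimes> sigma1 P \<rho> = sigma1 P \<rho> [^] a \<otimes> sigma2 P \<rho> [^] b"
    unfolding word_eval_append[of \<phi>, OF car] word_eval_pow[of \<phi>, OF car] s1 s2 .
qed

text \<open>An \<open>r\<close> in the cyclic group of \<open>z\<close> commutes with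
  \<open>z\<close> but also inverts it. So \<open>z^2\<close> is trivial, and the cyclic group
  contains only the identity and \<open>z\<close>.\<close>

lemma (in group) involution_in_cyclic:
  assumes z: "z \<in> carrier G" and r: "r \<in> carrier G" "r \<otimes> r = \<one>" "r \<otimes> z \<otimes> r = inv z"
    and eq: "z [^] (k :: int) = r"
  shows "r = \<one> \<or> r = z"
proof -
  have "z [^] k \<otimes> z = z \<otimes> z [^] k"
    using z int_pow_mult[OF z, of k 1] int_pow_mult[OF z, of 1 k] by (simp add: int_pow_1 add.commute)
  then have "r \<otimes> z \<otimes> r = z \<otimes> (r \<otimes> r)" using eq z r by (simp add: m_assoc)
  then have "inv z = z" using r z by simp
  then have zz: "z [^] (2 :: int) = \<one>"
    using z int_pow_mult[OF z, of 1 1] by (simp add: int_pow_1) (metis l_inv)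
  obtain m where "k = 2 * m \<or> k = 2 * m + 1" by (metis evenE oddE)
  moreover have "z [^] (2 * m) = \<one>" using z zz by (simp flip: int_pow_pow)
  ultimately have "z [^] k = \<one> \<or> z [^] k = z"
    using z int_pow_mult[OF z, of "2 * m" 1] by (auto simp: int_pow_1)
  then show ?thesis using eq by simp
qed

section \<open>Stabilizers and the base reflections\<close>

context abstract_polyhedron
begin

text \<open>The only edges between \<open>v\<close> and \<open>f\<close> are \<open>e\<close> and
  \<open>r e\<close>, so \<open>g\<close> agrees on the flag with either the identity or
  \<open>r\<close>.\<close>

lemma aut_fixes_vertex_and_face:
  assumes g: "g \<in> carrier (aut_group P)" and r: "r \<in> carrier (aut_group P)"
    and rr: "r \<otimes>\<^bsub>aut_group P\<^esub> r = \<one>\<^bsub>aut_group P\<^esub>"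
    and flag: "v \<in> vertices P" "e \<in> edges P" "f \<in> faces P" "v \<preceq> e" "e \<preceq> f"
    and rv: "r v = v" and rf: "r f = f" and re: "r e \<noteq> e" and gv: "g v = v" and gf: "g f = f"
  shows "g = \<one>\<^bsub>aut_group P\<^esub> \<or> g = r"
proof -
  interpret group "aut_group P" by (rule group_aut_group)
  have el: "v \<in> elems P" "e \<in> elems P" "f \<in> elems P" using flag of_rankD by blast+
  let ?D = "{d \<in> edges P. v \<preceq> d \<and> d \<preceq> f}"
  have D: "h e \<in> ?D" if "h \<in> carrier (aut_group P)" "h v = v" "h f = f" for h
    using aut_of_rank[OF that(1) flag(2)] aut_leq[OF that(1) el(1,2)] aut_leq[OF that(1) el(2,3)] that flag
    by simp
  have "card ?D = 2" using card_edges_between flag leq_trans by blast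
  moreover have "e \<in> ?D" "r e \<in> ?D" "g e \<in> ?D" using flag D[OF r rv rf] D[OF g gv gf] by simp_all
  ultimately have "g e = e \<or> g e = r e"
    using re unfolding card_2_iff by (metis (no_types, lifting) insertE singletonD)
  then show ?thesis
  proof
    assume "g e = e"
    then show ?thesis using aut_fixes_flag[OF g flag gv _ gf] by blast
  next
    assume ge: "g e = r e"
    have rre: "r (r e) = e" using aut_mult[OF r r el(2)] rr el by (simp add: aut_one)
    have "r \<otimes>\<^bsub>aut_group P\<^esub> g = \<one>\<^bsub>aut_group P\<^esub>"
      by (rule aut_fixes_flag[OF m_closed[OF r g] flag])
        (simp_all add: aut_mult r g el gv gf rv rf ge rre)
    then have "g = r" using r g rr by (metis l_cancel)
    then show ?thesis ..
  qed
qed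

text \<open>Adjacency compares flags as sets. Since automorphisms preserve rank and a flag has one
  member of each rank, it becomes a statement about single elements.\<close>

lemma base_reflections_fix:
  assumes "base_reflections P \<Phi> \<rho>"
  obtains v e f where "v \<in> vertices P" "e \<in> edges P" "f \<in> faces P" "v \<preceq> e" "e \<preceq> f"
    "\<rho> 0 e = e" "\<rho> 0 f = f" "\<rho> 0 v \<noteq> v"
    "\<rho> 1 v = v" "\<rho> 1 f = f" "\<rho> 1 e \<noteq> e"
    "\<rho> 2 v = v" "\<rho> 2 e = e" "\<rho> 2 f \<noteq> f"
    "\<rho> 0 \<in> carrier (aut_group P)" "\<rho> 1 \<in> carrier (aut_group P)" "\<rho> 2 \<in> carrier (aut_group P)"
proof -
  have \<rho>: "\<rho> n \<in> carrier (aut_group P)" and adj: "flag_adjacent P n \<Phi> (\<rho> n ` \<Phi>)" if "n \<in> {0, 1, 2}" for n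
    using assms that unfolding base_reflections_def by blast+
  have "\<Phi> \<in> flags P" using assms by (simp add: base_reflections_def)
  then obtain v e f where \<Phi>: "\<Phi> = {v, e, f}"
    and flag: "v \<in> vertices P" "e \<in> edges P" "f \<in> faces P" "v \<preceq> e" "e \<preceq> f"
    unfolding flags_eq by blast
  have el: "\<Phi> \<subseteq> elems P" using flag of_rankD unfolding \<Phi> by blast
  have same_rk: "z = w" if "z \<in> \<Phi>" "w \<in> \<Phi>" "rk P z = rk P w" for z w
    using that flag unfolding \<Phi> by (auto simp: of_rank_def)
  have fixed: "\<rho> n z = z" if n: "n \<in> {0, 1, 2}" and z: "z \<in> \<Phi>" "rk P z \<noteq> n" for n z
  proof -
    have rkz: "rk P (\<rho> n z) = rk P z" using aut_rk[OF \<rho>[OF n]] el z(1) by blast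
    then have "\<rho> n z \<in> {x \<in> \<rho> n ` \<Phi>. rk P x \<noteq> n}" using z by simp
    then have "\<rho> n z \<in> \<Phi>" using adj[OF n] unfolding flag_adjacent_def by blast
    then show ?thesis using same_rk rkz z(1) by blast
  qed
  have moved: "\<rho> n z \<noteq> z" if n: "n \<in> {0, 1, 2}" and z: "z \<in> \<Phi>" "rk P z = n" for n z
  proof
    assume zz: "\<rho> n z = z"
    have "\<rho> n w = w" if "w \<in> \<Phi>" for w
      using fixed[OF n that] same_rk[OF that z(1)] zz z(2) by metis
    then have "\<rho> n ` \<Phi> = \<Phi>" by simp
    then show False using adj[OF n] by (simp add: flag_adjacent_def)
  qed
  have rk: "rk P v = 0" "rk P e = 1" "rk P f = 2" using flag by (simp_all add: of_rank_def)
  show thesis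
    by (rule that[OF flag]) (use fixed moved rk \<rho> in \<open>simp_all add: \<Phi>\<close>)
qed

end

text \<open>Modulo 4 the odd number \<open>m\<close> is its own inverse, so \<open>m * n = 3\<close>
  forces \<open>n = 1\<close> or \<open>n = 3\<close> according to \<open>m\<close>; then
  \<open>i = m * n - 1\<close> is known modulo \<open>4 * m\<close>.\<close>

lemma residue_quarter:
  fixes i m n :: int
  assumes "odd m" "i + 1 = m * n" "4 dvd m * n - 3"
  shows "if m mod 4 = 3 then 4 * m dvd i - (m - 1) else 4 * m dvd i - (3 * m - 1)"
proof -
  have "m mod 4 = 3 \<or> m mod 4 = 1" using assms(1) by presburger
  then consider "m mod 4 = 3" | "m mod 4 = 1" by blast
  then show ?thesis
  proof cases
    case 1
    then obtain k where k: "m = 4 * k + 3" by (metis mult_div_mod_eq)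
    have "3 * n - 3 = (m * n - 3) - 4 * (k * n)" unfolding k by (simp add: algebra_simps)
    also have "4 dvd \<dots>" using assms(3) by (rule dvd_diff) simp
    finally have "4 dvd 3 * n - 3" .
    then have "4 dvd n - 1" by presburger
    then have "4 * m dvd (n - 1) * m" by simp
    also have "(n - 1) * m = i - (m - 1)" using assms(2) by (simp add: algebra_simps)
    finally show ?thesis using 1 by simp
  next
    case 2
    then obtain k where k: "m = 4 * k + 1" by (metis mult_div_mod_eq)
    have "n - 3 = (m * n - 3) - 4 * (k * n)" unfolding k by (simp add: algebra_simps)
    also have "4 dvd \<dots>" using assms(3) by (rule dvd_diff) simp
    finally have "4 dvd n - 3" .
    then have "4 * m dvd (n - 3) * m" by simp
    also have "(n - 3) * m = i - (3 * m - 1)" using assms(2) by (simp add: algebra_simps)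
    finally show ?thesis using 2 by simp
  qed
qed

lemma (in abstract_polyhedron) tight_Delta_rotation_action:
  fixes G (structure)
  assumes G_def: "G = aut_group P" and tight: "tight P p q"
    and refl: "base_reflections P \<Phi> \<rho>"
    and ord1: "group.ord G (sigma1 P \<rho>) = p"
    and ord2: "group.ord G (sigma2 P \<rho>) = q"
    and Delta: "aut_group_is_Delta P \<rho> p q i j a b"
  obtains v where "Delta_rotation_action G (sigma1 P \<rho>) (sigma2 P \<rho>) (\<rho> 1)
    (int p) (int q) i j a b (\<lambda>g. g) v"
proof -
  interpret group G unfolding G_def by (rule group_aut_group)
  define x y r where xyr: "x = sigma1 P \<rho>" "y = sigma2 P \<rho>" "r = \<rho> 1"
  obtain v e f where flag: "v \<in> vertices P" "e \<in> edges P" "f \<in> faces P" "v \<preceq> e" "e \<preceq> f"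
    and r0: "\<rho> 0 e = e" "\<rho> 0 f = f" "\<rho> 0 v \<noteq> v"
    and r1: "r v = v" "r f = f" "r e \<noteq> e"
    and r2: "\<rho> 2 v = v" "\<rho> 2 e = e" "\<rho> 2 f \<noteq> f"
    and \<rho>: "\<rho> 0 \<in> carrier G" "r \<in> carrier G" "\<rho> 2 \<in> carrier G"
    using base_reflections_fix[OF refl] unfolding G_def xyr by metis
  have el: "v \<in> elems P" "e \<in> elems P" "f \<in> elems P" using flag of_rankD by blast+
  note rels = aut_group_is_Delta_relations[OF Delta G_def, folded xyr]
  have x: "x = \<rho> 0 \<otimes> r" and y: "y = r \<otimes> \<rho> 2" by (simp_all add: xyr sigma1_def sigma2_def G_def)
  have xc: "x \<in> carrier G" and yc: "y \<in> carrier G" using x y \<rho> by simp_all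
  have mult: "(g \<otimes> h) z = g (h z)" if "g \<in> carrier G" "h \<in> carrier G" "z \<in> elems P" for g h z
    using aut_mult that unfolding G_def by blast
  have one: "\<one> z = z" if "z \<in> elems P" for z
    using that unfolding G_def aut_one by simp
  have assoc_cancel: "r \<otimes> (r \<otimes> z) = z" "\<rho> 0 \<otimes> (\<rho> 0 \<otimes> z) = z" if "z \<in> carrier G" for z
    using that \<rho> rels(1,2) by (simp_all flip: m_assoc)
  have rx: "r \<otimes> x \<otimes> r = inv x"
  proof -
    have "r \<otimes> \<rho> 0 \<otimes> x = \<one>" using \<rho> rels(2) by (simp add: x m_assoc assoc_cancel)
    then have "inv x = r \<otimes> \<rho> 0" using inv_equality \<rho> xc by simp
    then show ?thesis using \<rho> rels(2) by (simp add: x m_assoc)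
  qed
  have ry: "r \<otimes> y \<otimes> r = inv y"
  proof -
    have "\<rho> 2 \<otimes> r \<otimes> y = \<one>" using \<rho> rels(3) by (simp add: y m_assoc assoc_cancel)
    then have "inv y = \<rho> 2 \<otimes> r" using inv_equality \<rho> yc by simp
    then show ?thesis using \<rho> by (simp add: y m_assoc assoc_cancel)
  qed
  have "x \<otimes> y = \<rho> 0 \<otimes> \<rho> 2" using \<rho> by (simp add: x y m_assoc assoc_cancel)
  then have xyxy: "x \<otimes> y \<otimes> (x \<otimes> y) = \<one>" using rels(4) by simp
  have pow_fixes: "(g [^] (k :: int)) z = z" if g: "g \<in> carrier G" "g z = z" and z: "z \<in> elems P" for g z k
  proof -
    have inv: "(inv g) z = z"
      using mult[of "inv g" g z] g z one[OF z] by simp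
    have "(h [^] n) z = z" if "h \<in> carrier G" "h z = z" for h and n :: nat
      using that by (induction n) (simp_all add: one[OF z] mult[OF _ _ z])
    then have pos: "(g [^] n) z = z" and neg: "(inv g [^] n) z = z" for n :: nat
      using g inv by blast+
    show ?thesis
    proof (cases k rule: int_cases2)
      case (nonneg n)
      then show ?thesis using pos by (simp only: int_pow_int)
    next
      case (nonpos n)
      then show ?thesis using neg by (simp only: int_pow_neg_int[OF g(1)] nat_pow_inv[OF g(1)])
    qed
  qed
  \<comment> \<open>The factors of \<open>x\<close> both fix the base face, and those of
    \<open>y\<close> both fix the base vertex.\<close>
  have x_f: "(x [^] (k :: int)) f = f" for k
    by (rule pow_fixes[OF xc _ el(3)]) (simp add: x mult \<rho> el r0 r1)
  have y_v: "(y [^] (k :: int)) v = v" for k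
    by (rule pow_fixes[OF yc _ el(1)]) (simp add: y mult \<rho> el r1 r2)
  have r_neq_one: "r \<noteq> \<one>" using r1(3) one[OF el(2)] by metis
  have "r \<noteq> x"
  proof
    assume "r = x"
    then have "\<rho> 0 = \<one>" using \<rho> x by (metis r_cancel l_one one_closed)
    then show False using r0(3) one[OF el(1)] by metis
  qed
  then have r_x: "x [^] (k :: int) \<noteq> r" for k
    using involution_in_cyclic[OF xc \<rho>(2) rels(2) rx] r_neq_one by blast
  have "r \<noteq> y"
  proof
    assume "r = y"
    then have "\<rho> 2 = \<one>" using \<rho> y by (metis l_cancel r_one one_closed)
    then show False using r2(3) one[OF el(3)] by metis
  qed
  then have r_y: "y [^] (k :: int) \<noteq> r" for k
    using involution_in_cyclic[OF yc \<rho>(2) rels(2) ry] r_neq_one by blast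
  have fixes_both: "g = \<one> \<or> g = r" if "g \<in> carrier G" "g v = v" "g f = f" for g
    using aut_fixes_vertex_and_face[OF _ _ _ flag r1 that(2,3)] that(1) \<rho>(2) rels(2) unfolding G_def by blast
  have ord_x: "x [^] (k :: int) = \<one> \<longleftrightarrow> int p dvd k" and ord_y: "y [^] (k :: int) = \<one> \<longleftrightarrow> int q dvd k" for k
    using int_pow_eq_id[OF xc] int_pow_eq_id[OF yc] ord1 ord2 by (simp_all add: xyr)
  \<comment> \<open>Such a power fixes \<open>v\<close> and \<open>f\<close>, so it is the identity
    or \<open>r\<close>, and \<open>r_x\<close> excludes \<open>r\<close>.\<close>
  have x_v: "x [^] (k :: int) = \<one>" if "(x [^] k) v = v" for k
    using fixes_both[OF _ that x_f] xc r_x by blast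
  have indep: "x [^] (k :: int) = \<one>" if "x [^] k \<otimes> y [^] (l :: int) = \<one>" for k l
  proof (rule x_v)
    have "(x [^] k) ((y [^] l) v) = \<one> v" using mult[of "x [^] k" "y [^] l" v] that el xc yc by simp
    then show "(x [^] k) v = v" by (simp add: y_v one el)
  qed
  have r_neq: "r \<noteq> x [^] (k :: int) \<otimes> y [^] (l :: int)" for k l
  proof
    assume eq: "r = x [^] k \<otimes> y [^] l"
    have "(x [^] k) ((y [^] l) v) = r v" using mult[of "x [^] k" "y [^] l" v] eq el xc yc by simp
    then have "x [^] k = \<one>" using x_v by (simp add: y_v r1)
    then show False using eq r_y[of l] yc by simp
  qed
  have fin: "finite (elems P)" and card_flags: "card (flags P) = 2 * p * q"
    and type: "has_type P p q" using tight by (simp_all add: tight_def)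
  have "flags P \<subseteq> Pow (elems P)"
    by (auto simp: flags_def pred_on.maxchain_def pred_on.chain_def)
  then have "finite (flags P)" using fin by (meson finite_Pow_iff finite_subset)
  moreover have "\<Phi> \<in> flags P" using refl by (simp add: base_reflections_def)
  ultimately have "card (flags P) > 0" by (auto simp: card_gt_0_iff)
  then have pq: "p > 0" "q > 0" using card_flags by simp_all
  \<comment> \<open>Tightness enters here: there are exactly \<open>p\<close> vertices, and the
    \<open>p\<close> distinct images of \<open>v\<close> under powers of \<open>x\<close> exhaust
    them.\<close>
  have "card (flags P) = card (vertices P) * (2 * q)"
    using type by (intro card_flags_eq[OF fin]) (simp add: has_type_def)
  then have card_V: "card (vertices P) = p" using card_flags pq by simp
  let ?x = "\<lambda>k. (x [^] int k) v"
  have inj: "inj_on ?x {..<p}"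
  proof (rule inj_onI)
    fix k l assume kl: "k \<in> {..<p}" "l \<in> {..<p}" "?x k = ?x l"
    have "(x [^] (- int l) \<otimes> x [^] int k) v = (x [^] (- int l) \<otimes> x [^] int l) v"
      using kl(3) by (simp add: mult xc el)
    then have "(x [^] (int k - int l)) v = v"
      using xc by (simp add: one el flip: int_pow_mult)
    then have "int p dvd int k - int l" using x_v ord_x by blast
    then show "k = l" using kl(1,2) by (simp add: cong_int_iff cong_def flip: cong_iff_dvd_diff)
  qed
  have V_closed: "g v \<in> vertices P" if "g \<in> carrier G" for g
    using aut_of_rank[OF _ flag(1)] that unfolding G_def by blast
  have "?x ` {..<p} \<subseteq> vertices P" using V_closed xc by auto
  moreover have "finite (vertices P)" using fin by (simp add: of_rank_def)
  ultimately have V: "?x ` {..<p} = vertices P"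
    using card_V inj by (intro card_subset_eq) (simp_all add: card_image)
  have total: "\<exists>k :: int. g v = (x [^] k) v" if "g \<in> carrier G" for g
  proof -
    have "g v \<in> vertices P" using V_closed that by blast
    then show ?thesis using V by blast
  qed
  \<comment> \<open>The action is evaluation of an automorphism, and \<open>act_mult\<close> is
    composition evaluated at the base vertex.\<close>
  have "Delta_rotation_action G x y r (int p) (int q) i j a b (\<lambda>g. g) v"
  proof unfold_locales
    show "(x [^] k) v = v \<Longrightarrow> int p dvd k" for k :: int using x_v ord_x by blast
    show "y v = v" using y_v[of 1] yc by (simp add: int_pow_1)
    show "y [^] (- 1 :: int) \<otimes> x [^] (1 :: int) = x [^] i \<otimes> (r \<otimes> y [^] j)"
      "y [^] (- 2 :: int) \<otimes> x [^] (1 :: int) = x [^] a \<otimes> y [^] b"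
      using rels(5,6) xc by (simp_all add: int_pow_1)
  qed (fact xc yc \<rho> rels(2) rx ry xyxy ord_x ord_y indep r_neq r1 | use pq in simp | simp add: mult el total)+
  then show thesis using that unfolding xyr by blast
qed

theorem theorem5p8:
  fixes P :: "'a ranked_poset"
    and \<Phi> :: "'a set"
    and \<rho> :: "nat \<Rightarrow> 'a \<Rightarrow> 'a"
    and p q :: nat
    and i j a b :: int
  assumes "polyhedron P"
    and "tight P p q"
    and "nonorientably_regular P \<Phi> \<rho>"
    and "group.ord (aut_group P) (sigma1 P \<rho>) = p"
    and "group.ord (aut_group P) (sigma2 P \<rho>) = q"
    and "aut_group_is_Delta P \<rho> p q i j a b"
  shows "(\<exists>k. odd k \<and> p = 4 * k) \<and>
    (3 dvd q \<and> (p \<noteq> 4 \<longrightarrow> (\<exists>k. odd k \<and> q = 6 * k))) \<and>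
    (if [p div 4 = 3] (mod 4)
     then [i = int (p div 4) - 1] (mod int p)
     else [i = int (3 * p div 4) - 1] (mod int p)) \<and>
    (if p \<noteq> 4
     then [j = 1 + int (q div 2)] (mod int q)
     else [j = 1] (mod int q) \<or> (even q \<and> [j = 1 + int (q div 2)] (mod int q))) \<and>
    [a = 1 + int (p div 2)] (mod int p) \<and>
    [b = 2] (mod int q)"
proof -
  interpret abstract_polyhedron P using assms(1) by unfold_locales
  have "base_reflections P \<Phi> \<rho>" using assms(3) by (simp add: nonorientably_regular_def)
  from tight_Delta_rotation_action[OF HOL.refl assms(2) this assms(4-6)]
  obtain v where "Delta_rotation_action (aut_group P) (sigma1 P \<rho>) (sigma2 P \<rho>) (\<rho> 1)
    (int p) (int q) i j a b (\<lambda>g. g) v" .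
  then interpret D: Delta_rotation_action "aut_group P" "sigma1 P \<rho>" "sigma2 P \<rho>" "\<rho> 1"
    "int p" "int q" i j a b "\<lambda>g. g" v .
  have three: "3 dvd q" using D.three_dvd_q by (metis int_dvd_int_iff of_nat_numeral)
  have a: "[a = 1 + int (p div 2)] (mod int p)"
    using D.p_dvd_a(2) by (simp add: cong_iff_dvd_diff zdiv_int algebra_simps)
  show ?thesis
  proof (cases "j - 1 \<in> group.inverted_powers (aut_group P) (sigma2 P \<rho>) (sigma1 P \<rho> [^]\<^bsub>aut_group P\<^esub> (1 :: int))")
    case True
    from D.j_inverted_imp[OF this] have p: "p = 4" and i: "4 dvd i - 2" and b: "int q dvd b - 2" by simp_all
    have j: "[j = 1] (mod int q) \<or> (even q \<and> [j = 1 + int (q div 2)] (mod int q))"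
    proof (cases "int q dvd j - 1")
      case False
      from dvd_double_not_dvd[OF D.dvd_a_j(2) this] show ?thesis
        by (simp add: cong_iff_dvd_diff zdiv_int algebra_simps)
    qed (simp add: cong_iff_dvd_diff)
    \<comment> \<open>Here \<open>p div 4\<close> is 1, so the second alternative for
      \<open>i\<close> applies, and it asks for \<open>i = 3 - 1\<close>.\<close>
    have "\<not> [1 = 3 :: nat] (mod 4)" by (simp add: cong_def)
    then show ?thesis using p three i j a b by (auto simp: cong_iff_dvd_diff intro: exI[of _ 1])
  next
    case False
    note q = D.j_not_inverted_imp[OF False]
    have p2: "int p = 2 * (int p div 2)" using D.p_dvd_a(1) by simp
    obtain m n where m: "int p = 4 * m" "odd m" and n: "i + 1 = m * n" "4 dvd m * n - 3"
      using D.quarter_p[OF p2 D.p_dvd_a(2) q(1)] .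
    obtain k where k: "m = int k" using m(1) D.p_pos 
      by (metis pos_int_cases zero_less_mult_pos zero_less_numeral)
    have p: "p = 4 * k" using m(1) k by simp
    have six: "6 dvd q" using q(2) by (metis int_dvd_int_iff of_nat_numeral)
    have "odd (q div 6)" using q(3) by (metis even_of_nat of_nat_div of_nat_numeral)
    moreover have "q = 6 * (q div 6)" using six by simp
    ultimately have "\<exists>k. odd k \<and> q = 6 * k" by blast
    moreover have "odd k" using m(2) k by simp
    moreover have "if [p div 4 = 3] (mod 4) then [i = int (p div 4) - 1] (mod int p)
        else [i = int (3 * p div 4) - 1] (mod int p)"
    proof -
      have "m mod 4 = int (k mod 4)" using k by (simp add: zmod_int)
      then have "[p div 4 = 3] (mod 4) \<longleftrightarrow> m mod 4 = 3" using p by (simp add: cong_def)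
      moreover have "int (p div 4) = m" "int (3 * p div 4) = 3 * m" using p k by simp_all
      ultimately show ?thesis
        using residue_quarter[OF m(2) n] m(1) by (simp add: cong_iff_dvd_diff)
    qed
    moreover have "even q" using six by (rule dvd_trans[rotated]) simp
    moreover have "[j = 1 + int (q div 2)] (mod int q)"
      using q(4) by (simp add: cong_iff_dvd_diff zdiv_int algebra_simps)
    moreover have "[b = 2] (mod int q)" using q(1) by (simp add: cong_iff_dvd_diff)
    ultimately show ?thesis using p three a by auto
  qed
qed

end
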